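(* Given a matrix $Y\in\mathbb{Z}^{2\times 2}$ and a finitely generated subgroup $H$ of $\mathbb{Z}^{2\times 2}$ (specified by a finite set of matrices generating it), it is decidable whether $Y$ belongs to $H$. That is, there is an algorithm which, on input a matrix $Y\in\mathbb{Z}^{2\times 2}$ and a finite list of matrices $h_1,\dots,h_n\in\mathbb{Z}^{2\times 2}$ generating (as a group) a subgroup $H$ of $\mathbb{Z}^{2\times 2}$, decides whether $Y\in H$.
   Context: $\mathbb{Z}^{2\times 2}$ denotes the set of $2\times 2$ matrices with integer entries, regarded as a monoid under matrix multiplication. A subgroup of $\mathbb{Z}^{2\times 2}$ is a subset that is a group under matrix multiplication. *)

theory Defs
  imports
    "HOL-Analysis.Finite_Cartesian_Product"
    "HOL-Algebra.Generated_Groups"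
    "HOL-Library.Nat_Bijection"
begin

type_synonym mat2 = "int ^ 2 ^ 2"

text \<open>
  A subgroup of the multiplicative monoid of integer matrices is a subset that is itself a group
  under matrix multiplication; its neutral element may be any idempotent matrix \<open>e\<close>,
  not only the identity matrix. A nonempty list in a subgroup determines \<open>e\<close> and hence the group
  it generates; the empty list generates every trivial group \<open>{e}\<close>.
\<close>

definition mat_structure :: "mat2 set \<Rightarrow> mat2 \<Rightarrow> mat2 monoid" where
  "mat_structure H e = \<lparr>carrier = H, mult = (\<lambda>A B. A ** B), one = e\<rparr>"

definition generates_subgroup :: "mat2 list \<Rightarrow> mat2 set \<Rightarrow> bool" where
  "generates_subgroup hs H \<longleftrightarrow>
     (\<exists>e. group (mat_structure H e) \<and> set hs \<subseteq> H \<and>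
          generate (mat_structure H e) (set hs) = H)"

text \<open>
  The model of computation: partial recursive functions on the natural numbers, given by
  Kleene's schemes. \<open>None\<close> means that the computation does not terminate (or that the number
  of arguments is wrong). In the clause for \<open>Mu\<close>, the least zero is at most the witness \<open>n\<close>,
  so \<open>f\<close> is defined and nonzero at all smaller arguments.
\<close>

datatype recf =
    Zero
  | Succ
  | Proj nat
  | Comp recf "recf list"
  | PrimRec recf recf
  | Mu recf

primrec eval :: "recf \<Rightarrow> nat list \<Rightarrow> nat option" where
  "eval Zero xs = Some 0"
| "eval Succ xs = (case xs of [x] \<Rightarrow> Some (Suc x) | _ \<Rightarrow> None)"
| "eval (Proj i) xs = (if i < length xs then Some (xs ! i) else None)"
| "eval (Comp f gs) xs = Option.bind (those (map (\<lambda>g. eval g xs) gs)) (eval f)"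
| "eval (PrimRec f g) xs =
     (case xs of
        [] \<Rightarrow> None
      | n # ys \<Rightarrow> rec_nat (eval f ys) (\<lambda>m r. Option.bind r (\<lambda>y. eval g (m # y # ys))) n)"
| "eval (Mu f) xs =
     (if \<exists>n. eval f (n # xs) = Some 0 \<and> (\<forall>m<n. eval f (m # xs) \<noteq> None)
      then Some (LEAST n. eval f (n # xs) = Some 0)
      else None)"

definition mat_encode :: "mat2 \<Rightarrow> nat" where
  "mat_encode A = list_encode (map int_encode [A $ 1 $ 1, A $ 1 $ 2, A $ 2 $ 1, A $ 2 $ 2])"

end

theory Submission
  imports Defs "HOL-Analysis.Cartesian_Space"
begin

text \<open>
  If the neutral element \<open>e\<close> is singular then, by Cayley-Hamilton, the group is contained in \<open>{e, -e}\<close>;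
  otherwise \<open>e = 1\<close> and the group lies in \<open>GL(2, Z)\<close>, which acts on the tree dual to the Farey
  tessellation. The edges of the tree are the walls \<open>K\<inverse> W\<close>, where \<open>W\<close> is the Farey edge joining \<open>0\<close> and
  \<open>\<infinity>\<close> and \<open>pos\<close> tells on which side of \<open>W\<close> an element lies. Counting the walls that separate two
  elements gives a left invariant, proper metric that satisfies Gromov's four-point condition with
  \<open>\<delta> = 0\<close>. Consequently, a set \<open>R\<close> of elements of length at most \<open>N\<close> that contains every product of
  two of its members of length at most \<open>N\<close> already contains every product of length at most \<open>N\<close> of
  arbitrarily many of its members: at a longest prefix, two adjacent factors can be merged. So a
  finite set \<open>R\<close> of this kind that contains the generators and their inverses but not \<open>Y\<close> certifies
  \<open>Y \<notin> H\<close>, and the elements of \<open>H\<close> of bounded length form such a set. Membership is certified by a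
  derivation of \<open>Y\<close> from the generators. An unbounded search for a certificate of either kind
  terminates.
\<close>

section \<open>Recursive functions\<close>

text \<open>Arguments are read from an infinite environment, of which only a finite prefix is passed to the
  program; this removes all arity side conditions from the closure properties.\<close>

definition computable :: "((nat \<Rightarrow> nat) \<Rightarrow> nat) \<Rightarrow> bool" where
  "computable F \<longleftrightarrow> (\<exists>f n. \<forall>e. eval f (map e [0..<n]) = Some (F e))"

lemma those_map_Some: "those (map (\<lambda>x. Some (h x)) xs) = Some (map h xs)"
  by (induction xs) auto

lemma eval_Comp_map:
  assumes "\<And>i. i < n \<Longrightarrow> eval (g i) xs = Some (h i)"
  shows "eval (Comp f (map g [0..<n])) xs = eval f (map h [0..<n])"
proof -
  have "map (\<lambda>i. eval (g i) xs) [0..<n] = map (\<lambda>i. Some (h i)) [0..<n]"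
    using assms by simp
  then show ?thesis by (simp only: eval.simps map_map comp_def those_map_Some) simp
qed

text \<open>Projections discard surplus arguments, so a program also exists at every larger arity;
  this brings several programs to a common arity.\<close>

lemma computable_on:
  assumes "computable F"
  obtains n where "\<And>m. n \<le> m \<Longrightarrow> \<exists>f. \<forall>e. eval f (map e [0..<m]) = Some (F e)"
proof -
  obtain f n where f: "\<And>e. eval f (map e [0..<n]) = Some (F e)"
    using assms unfolding computable_def by blast
  have "\<exists>f. \<forall>e. eval f (map e [0..<m]) = Some (F e)" if "n \<le> m" for m
  proof (intro exI allI)
    fix e :: "nat \<Rightarrow> nat"
    show "eval (Comp f (map Proj [0..<n])) (map e [0..<m]) = Some (F e)"
      using that by (subst eval_Comp_map[where h = e]) (simp_all add: f)
  qed
  then show thesis by (rule that)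
qed

text \<open>The program for \<open>F\<close> reads only \<open>n\<close> variables, so finitely many
  of the \<open>G i\<close> matter and their programs can be run on a common prefix.\<close>

lemma computable_subst:
  assumes F: "computable F" and G: "\<And>i. computable (G i)"
  shows "computable (\<lambda>e. F (\<lambda>i. G i e))"
proof -
  obtain f n where f: "\<And>e. eval f (map e [0..<n]) = Some (F e)"
    using F unfolding computable_def by blast
  have "\<exists>k. \<forall>m\<ge>k. \<exists>g. \<forall>e. eval g (map e [0..<m]) = Some (G i e)" for i
    using computable_on[OF G[of i]] by metis
  then obtain k where k: "\<And>i m. k i \<le> m \<Longrightarrow> \<exists>g. \<forall>e. eval g (map e [0..<m]) = Some (G i e)"
    by metis
  define m where "m = Max (k ` {..n})"
  have "\<exists>g. \<forall>e. eval g (map e [0..<m]) = Some (G i e)" if "i < n" for i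
    using that by (intro k) (auto simp: m_def)
  then obtain g where g: "\<And>i e. i < n \<Longrightarrow> eval (g i) (map e [0..<m]) = Some (G i e)"
    by metis
  have "eval (Comp f (map g [0..<n])) (map e [0..<m]) = Some (F (\<lambda>i. G i e))" for e
    by (subst eval_Comp_map[where h = "\<lambda>i. G i e"]) (simp_all add: f g)
  then show ?thesis unfolding computable_def by blast
qed

lemma computable_var: "computable (\<lambda>e. e i)"
  unfolding computable_def by (intro exI[of _ "Proj i"] exI[of _ "Suc i"]) (simp add: nth_append)

lemma computable_Suc:
  assumes "computable F" shows "computable (\<lambda>e. Suc (F e))"
proof -
  have "computable (\<lambda>e. Suc (e 0))"
    unfolding computable_def by (intro exI[of _ Succ] exI[of _ 1]) simp
  from computable_subst[OF this, of "\<lambda>_. F"] assms show ?thesis by simp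
qed

lemma computable_const: "computable (\<lambda>_. c)"
proof (induction c)
  case 0
  show ?case unfolding computable_def by (intro exI[of _ Zero]) simp
qed (rule computable_Suc)

lemma map_case_nat: "map (case_nat x e) [0..<Suc n] = x # map e [0..<n]"
  by (subst map_upt_Suc) simp

text \<open>The step function sees the counter as variable 0, the accumulator as variable 1 and the
  outer environment behind them, which is the order in which \<open>PrimRec\<close> passes its
  arguments.\<close>

lemma computable_rec:
  assumes A: "computable A" and F: "computable F"
    and G: "computable (\<lambda>e. G (e 0) (e (Suc 0)) (\<lambda>i. e (Suc (Suc i))))"
  shows "computable (\<lambda>e. rec_nat (F e) (\<lambda>m y. G m y e) (A e))"
proof -
  obtain n where n: "\<And>m. n \<le> m \<Longrightarrow> \<exists>f. \<forall>e. eval f (map e [0..<m]) = Some (F e)"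
    using computable_on[OF F] by blast
  obtain n' where n': "\<And>m. n' \<le> m \<Longrightarrow>
      \<exists>f. \<forall>e. eval f (map e [0..<m]) = Some (G (e 0) (e (Suc 0)) (\<lambda>i. e (Suc (Suc i))))"
    using computable_on[OF G] by blast
  define k where "k = max n n'"
  obtain f where f: "\<And>e. eval f (map e [0..<k]) = Some (F e)"
    using n[of k] by (auto simp: k_def)
  obtain g where g: "\<And>e. eval g (map e [0..<Suc (Suc k)]) =
      Some (G (e 0) (e (Suc 0)) (\<lambda>i. e (Suc (Suc i))))"
    using n'[of "Suc (Suc k)"] unfolding k_def by (metis le_SucI max.cobounded2)
  have g': "eval g (m # y # map e [0..<k]) = Some (G m y e)" for m y e
    using g[of "case_nat m (case_nat y e)"] unfolding map_case_nat by simp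
  let ?R = "\<lambda>e x. rec_nat (F e) (\<lambda>m y. G m y e) x"
  have ev: "eval (PrimRec f g) (x # map e [0..<k]) = Some (?R e x)" for x e
    by (induction x) (simp_all add: f g')
  have "eval (PrimRec f g) (map e [0..<Suc k]) = Some (?R (\<lambda>i. e (Suc i)) (e 0))" for e
  proof -
    have "e = case_nat (e 0) (\<lambda>i. e (Suc i))"
      by (auto split: nat.split)
    then show ?thesis using ev[of "e 0" "\<lambda>i. e (Suc i)"] map_case_nat by metis
  qed
  then have "computable (\<lambda>e. ?R (\<lambda>i. e (Suc i)) (e 0))"
    unfolding computable_def by blast
  \<comment> \<open>So far the recursion argument is variable 0; substituting \<open>A\<close> there
    and shifting the others back restores the original environment.\<close>
  from computable_subst[OF this, of "\<lambda>i. case_nat A (\<lambda>j e. e j) i"]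
  show ?thesis using A computable_var by (simp split: nat.split)
qed

section \<open>Arithmetic operations and bounded sums\<close>

lemma computable_subst1:
  assumes "computable (\<lambda>e. f (e 0))" "computable A"
  shows "computable (\<lambda>e. f (A e))"
  using computable_subst[OF assms(1), of "\<lambda>_. A"] assms(2) by simp

lemma computable_subst2:
  assumes f: "computable (\<lambda>e. f (e 0) (e (Suc 0)))" and "computable A" "computable B"
  shows "computable (\<lambda>e. f (A e) (B e))"
  using computable_subst[OF f, of "\<lambda>i. if i = 0 then A else B"] assms(2,3) by simp

lemma computable_rec1:
  assumes "computable A" "computable (\<lambda>e. g (e 0) (e (Suc 0)))"
  shows "computable (\<lambda>e. rec_nat c g (A e))"
  by (rule computable_rec[OF assms(1) computable_const, of "\<lambda>m y _. g m y" c, simplified])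
     (use assms(2) in simp)

lemma computable_add:
  assumes "computable A" "computable B" shows "computable (\<lambda>e. A e + B e)"
proof -
  have "rec_nat x (\<lambda>_ y. Suc y) n = x + n" for x n by (induction n) auto
  then show ?thesis
    using computable_rec[OF assms(2,1), of "\<lambda>m y e. Suc y"] computable_Suc[OF computable_var] by simp
qed

lemma computable_pred:
  assumes "computable A" shows "computable (\<lambda>e. A e - 1)"
proof -
  have "rec_nat 0 (\<lambda>m y. m) n = n - 1" for n by (cases n) auto
  then show ?thesis
    using computable_rec[OF assms computable_const, of "\<lambda>m y e. m" 0] computable_var by simp
qed

lemma computable_diff:
  assumes "computable A" "computable B" shows "computable (\<lambda>e. A e - B e)"
proof -
  have "rec_nat x (\<lambda>_ y. y - 1) n = x - n" for x n by (induction n) auto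
  then show ?thesis
    using computable_rec[OF assms(2,1), of "\<lambda>m y e. y - 1"] computable_pred[OF computable_var] by simp
qed

lemma computable_mult:
  assumes "computable A" "computable B" shows "computable (\<lambda>e. A e * B e)"
proof -
  have "computable (\<lambda>e. rec_nat 0 (\<lambda>_ y. y + A e) (B e))"
  proof (rule computable_rec[OF assms(2) computable_const])
    have "computable (\<lambda>e. A (\<lambda>i. e (Suc (Suc i))))"
      by (rule computable_subst[OF assms(1)]) (rule computable_var)
    then show "computable (\<lambda>e. e (Suc 0) + A (\<lambda>i. e (Suc (Suc i))))"
      by (intro computable_add computable_var)
  qed
  moreover have "rec_nat 0 (\<lambda>_ y. y + x) n = x * n" for x n by (induction n) auto
  ultimately show ?thesis by simp
qed

text \<open>Bound variables are de Bruijn indices: the body reads the summation index as variable 0.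
  The bounded quantifiers below follow the same convention.\<close>

lemma computable_sum:
  assumes "computable B" "computable (\<lambda>e. F (e 0) (\<lambda>i. e (Suc i)))"
  shows "computable (\<lambda>e. \<Sum>m<B e. F m e)"
proof -
  have "computable (\<lambda>e. rec_nat 0 (\<lambda>m y. y + F m e) (B e))"
  proof (rule computable_rec[OF assms(1) computable_const])
    \<comment> \<open>Inside the recursion the accumulator occupies variable 1, so the body has to
      skip it.\<close>
    have "computable (\<lambda>e. F (e 0) (\<lambda>i. e (Suc (Suc i))))"
      using computable_subst[OF assms(2), of "\<lambda>i. case_nat (\<lambda>e. e 0) (\<lambda>j e. e (Suc (Suc j))) i"]
        computable_var by (simp split: nat.split)
    then show "computable (\<lambda>e. e (Suc 0) + F (e 0) (\<lambda>i. e (Suc (Suc i))))"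
      by (intro computable_add computable_var)
  qed
  moreover have "rec_nat 0 (\<lambda>m y. y + f m) n = (\<Sum>m<n. f m)" for f :: "nat \<Rightarrow> nat" and n
    by (induction n) auto
  ultimately show ?thesis by simp
qed

section \<open>Decidable predicates and bounded quantifiers\<close>

definition decidable :: "((nat \<Rightarrow> nat) \<Rightarrow> bool) \<Rightarrow> bool" where
  "decidable P \<longleftrightarrow> computable (\<lambda>e. of_bool (P e))"

lemma computable_of_bool: "decidable P \<Longrightarrow> computable (\<lambda>e. of_bool (P e))"
  by (simp add: decidable_def)

lemma decidable_le:
  assumes "computable A" "computable B" shows "decidable (\<lambda>e. A e \<le> B e)"
proof -
  have "computable (\<lambda>e. 1 - (A e - B e))"
    by (intro computable_diff computable_const assms)
  moreover have "1 - (A e - B e) = of_bool (A e \<le> B e)" for e by simp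
  ultimately show ?thesis unfolding decidable_def by simp
qed

lemma decidable_less:
  assumes "computable A" "computable B" shows "decidable (\<lambda>e. A e < B e)"
  using decidable_le[OF computable_Suc[OF assms(1)] assms(2)] by (simp add: Suc_le_eq)

lemma decidable_not:
  assumes "decidable P" shows "decidable (\<lambda>e. \<not> P e)"
proof -
  have "computable (\<lambda>e. 1 - of_bool (P e))"
    by (intro computable_diff computable_const computable_of_bool assms)
  moreover have "(1 - of_bool (P e) :: nat) = of_bool (\<not> P e)" for e by simp
  ultimately show ?thesis unfolding decidable_def by simp
qed

lemma decidable_conj:
  assumes "decidable P" "decidable Q" shows "decidable (\<lambda>e. P e \<and> Q e)"
  using computable_mult[OF assms[unfolded decidable_def]] unfolding decidable_def
  by (simp only: of_bool_conj)

lemma decidable_disj: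
  assumes "decidable P" "decidable Q" shows "decidable (\<lambda>e. P e \<or> Q e)"
  using decidable_not[OF decidable_conj[OF assms[THEN decidable_not]]] by simp

lemma decidable_imp:
  assumes "decidable P" "decidable Q" shows "decidable (\<lambda>e. P e \<longrightarrow> Q e)"
  unfolding imp_conv_disj by (intro decidable_disj decidable_not assms)

lemma decidable_iff:
  assumes "decidable P" "decidable Q" shows "decidable (\<lambda>e. P e = Q e)"
  unfolding iff_conv_conj_imp by (intro decidable_conj decidable_imp assms)

lemma decidable_eq:
  assumes "computable A" "computable B" shows "decidable (\<lambda>e. A e = B e)"
  using decidable_conj[OF decidable_le[OF assms] decidable_le[OF assms(2,1)]]
  by (simp add: order_eq_iff)

lemma decidable_bex:
  assumes "computable B" "decidable (\<lambda>e. P (e 0) (\<lambda>i. e (Suc i)))"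
  shows "decidable (\<lambda>e. \<exists>m<B e. P m e)"
proof -
  have "decidable (\<lambda>e. 0 < (\<Sum>m<B e. of_bool (P m e) :: nat))"
    by (intro decidable_less computable_sum computable_const computable_of_bool assms)
  moreover have "0 < (\<Sum>m<B e. of_bool (P m e) :: nat) \<longleftrightarrow> (\<exists>m<B e. P m e)" for e
    unfolding neq0_conv[symmetric] by auto
  ultimately show ?thesis by simp
qed

lemma decidable_ball:
  assumes "computable B" "decidable (\<lambda>e. P (e 0) (\<lambda>i. e (Suc i)))"
  shows "decidable (\<lambda>e. \<forall>m<B e. P m e)"
proof -
  have "decidable (\<lambda>e. \<not> (\<exists>m<B e. \<not> P m e))"
    by (intro decidable_not decidable_bex assms)
  then show ?thesis by simp
qed

lemma computable_if:
  assumes "decidable P" "computable A" "computable B"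
  shows "computable (\<lambda>e. if P e then A e else B e)"
proof -
  have "computable (\<lambda>e. of_bool (P e) * A e + of_bool (\<not> P e) * B e)"
    by (intro computable_add computable_mult computable_of_bool decidable_not assms)
  moreover have "of_bool (P e) * A e + of_bool (\<not> P e) * B e = (if P e then A e else B e)" for e
    by simp
  ultimately show ?thesis by simp
qed

text \<open>Only the summand with \<open>m = F e\<close> survives in a sum over all candidate
  values. This makes the inverses of coding functions computable by searching their graphs.\<close>

lemma computable_graph:
  assumes "computable B" "decidable (\<lambda>e. F (\<lambda>i. e (Suc i)) = e 0)" "\<And>e. F e \<le> B e"
  shows "computable F"
proof -
  have "computable (\<lambda>e. \<Sum>m<Suc (B e). if F e = m then m else 0)"
    by (intro computable_sum computable_if computable_Suc computable_var computable_const assms)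
  moreover have "(\<Sum>m<Suc (B e). if F e = m then m else 0) = F e" for e
    using assms(3)[of e] by (subst sum.delta') auto
  ultimately show ?thesis by simp
qed

lemma computable_div2:
  assumes "computable A" shows "computable (\<lambda>e. A e div 2)"
proof -
  have "computable (\<lambda>e. rec_nat 0 (\<lambda>m y. m - y) (A e))"
    by (rule computable_rec1[OF assms]) (intro computable_diff computable_var)
  \<comment> \<open>Rests on (n + 1) div 2 = n - n div 2.\<close>
  moreover have "rec_nat 0 (\<lambda>m y. m - y) n = n div 2" for n :: nat
  proof (induction n)
    case (Suc n)
    then have "rec_nat 0 (\<lambda>m y. m - y) (Suc n) = n - n div 2" by simp
    then show ?case by presburger
  qed simp
  ultimately show ?thesis by simp
qed

lemma decidable_even:
  assumes "computable A" shows "decidable (\<lambda>e. even (A e))"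
proof -
  have "decidable (\<lambda>e. A e div 2 + A e div 2 = A e)"
    by (intro decidable_eq computable_add computable_div2 assms)
  moreover have "n div 2 + n div 2 = n \<longleftrightarrow> even n" for n :: nat by presburger
  ultimately show ?thesis by simp
qed

section \<open>Codes of pairs and lists\<close>

lemma computable_prod_encode:
  assumes "computable A" "computable B" shows "computable (\<lambda>e. prod_encode (A e, B e))"
  unfolding prod_encode_def prod.case triangle_def
  by (intro computable_add computable_div2 computable_mult computable_Suc assms)

lemma computable_fst_prod_decode:
  assumes "computable A" shows "computable (\<lambda>e. fst (prod_decode (A e)))"
proof (rule computable_subst1[OF _ assms])
  have *: "fst (prod_decode n) = a \<longleftrightarrow> (\<exists>b<Suc n. prod_encode (a, b) = n)" for n a
    by (metis fst_conv le_imp_less_Suc le_prod_encode_2 prod.collapse prod_decode_inverse prod_encode_inverse)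
  have "decidable (\<lambda>e. fst (prod_decode (e (Suc 0))) = e 0)"
    unfolding * by (intro decidable_bex decidable_eq computable_prod_encode computable_Suc computable_var)
  then show "computable (\<lambda>e. fst (prod_decode (e 0)))"
    by (rule computable_graph[OF computable_var[of 0]])
      (metis le_prod_encode_1 prod.collapse prod_decode_inverse)
qed

lemma computable_snd_prod_decode:
  assumes "computable A" shows "computable (\<lambda>e. snd (prod_decode (A e)))"
proof (rule computable_subst1[OF _ assms])
  have *: "snd (prod_decode n) = b \<longleftrightarrow> (\<exists>a<Suc n. prod_encode (a, b) = n)" for n b
    by (metis snd_conv le_imp_less_Suc le_prod_encode_1 prod.collapse prod_decode_inverse prod_encode_inverse)
  have "decidable (\<lambda>e. snd (prod_decode (e (Suc 0))) = e 0)"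
    unfolding * by (intro decidable_bex decidable_eq computable_prod_encode computable_Suc computable_var)
  then show "computable (\<lambda>e. snd (prod_decode (e 0)))"
    by (rule computable_graph[OF computable_var[of 0]])
      (metis le_prod_encode_2 prod.collapse prod_decode_inverse)
qed

text \<open>\<open>list_encode\<close> codes \<open>x # xs\<close> as the successor of a pair, hence
  the predecessor. On 0 both the head and the tail are 0, so iterating \<open>code_tl\<close> past
  the end stays at the code of the empty list.\<close>

definition code_hd :: "nat \<Rightarrow> nat" where
  "code_hd c = fst (prod_decode (c - 1))"

definition code_tl :: "nat \<Rightarrow> nat" where
  "code_tl c = snd (prod_decode (c - 1))"

lemma computable_code_hd: "computable A \<Longrightarrow> computable (\<lambda>e. code_hd (A e))"
  unfolding code_hd_def by (intro computable_fst_prod_decode computable_pred)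

lemma computable_code_tl: "computable A \<Longrightarrow> computable (\<lambda>e. code_tl (A e))"
  unfolding code_tl_def by (intro computable_snd_prod_decode computable_pred)

lemma computable_code_drop:
  assumes "computable A" "computable B" shows "computable (\<lambda>e. (code_tl ^^ A e) (B e))"
proof -
  have "computable (\<lambda>e. rec_nat (B e) (\<lambda>_. code_tl) (A e))"
    by (rule computable_rec[OF assms, of "\<lambda>_ y _. code_tl y"])
      (intro computable_code_tl computable_var)
  moreover have "rec_nat x (\<lambda>_. code_tl) n = (code_tl ^^ n) x" for x n
    by (induction n) auto
  ultimately show ?thesis by simp
qed

lemma list_decode_rec: "list_decode c = (if c = 0 then [] else code_hd c # list_decode (code_tl c))"
  by (cases c) (simp_all add: code_hd_def code_tl_def split: prod.split)

lemma list_decode_code_tl: "list_decode (code_tl c) = tl (list_decode c)"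
proof (cases "c = 0")
  case True
  have "prod_decode 0 = (0, 0)"
    by (simp add: prod_decode_def prod_decode_aux.simps)
  with True show ?thesis by (simp add: code_tl_def)
next
  case False
  then show ?thesis by (simp add: list_decode_rec[of c])
qed

lemma list_decode_code_drop: "list_decode ((code_tl ^^ i) c) = drop i (list_decode c)"
  by (induction i) (simp_all add: list_decode_code_tl drop_Suc tl_drop)

lemma list_decode_eq_Nil: "list_decode c = [] \<longleftrightarrow> c = 0"
  using list_decode_eq[of c 0] by simp

lemma code_drop_eq_0: "(code_tl ^^ i) c = 0 \<longleftrightarrow> length (list_decode c) \<le> i"
  unfolding list_decode_eq_Nil[symmetric] list_decode_code_drop by simp

lemma code_hd_drop:
  assumes "i < length (list_decode c)"
  shows "code_hd ((code_tl ^^ i) c) = list_decode c ! i"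
proof -
  have "(code_tl ^^ i) c \<noteq> 0" using assms by (simp add: code_drop_eq_0)
  then have "hd (list_decode ((code_tl ^^ i) c)) = code_hd ((code_tl ^^ i) c)"
    by (subst list_decode_rec) simp
  then show ?thesis using assms by (simp add: list_decode_code_drop hd_drop_conv_nth)
qed

lemma length_le_list_encode: "length xs \<le> list_encode xs"
proof (induction xs)
  case (Cons x xs)
  then show ?case using le_prod_encode_2[of "list_encode xs" x] by simp
qed simp

lemma less_list_encode: "x \<in> set xs \<Longrightarrow> x < list_encode xs"
proof (induction xs)
  case (Cons y ys)
  then show ?case
    using le_prod_encode_1[of y "list_encode ys"] le_prod_encode_2[of "list_encode ys" y]
    by (auto simp: less_Suc_eq_le)
qed simp

definition code_set :: "nat \<Rightarrow> nat set" where
  "code_set c = set (list_decode c)"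

lemma code_set_less: "x \<in> code_set c \<Longrightarrow> x < c"
  unfolding code_set_def using less_list_encode[of x "list_decode c"] by simp

lemma code_set_list_encode: "code_set (list_encode xs) = set xs"
  by (simp add: code_set_def)

lemma length_list_decode_le: "length (list_decode c) \<le> c"
  using length_le_list_encode[of "list_decode c"] by simp

lemma decidable_code_set:
  assumes "computable A" "computable B" shows "decidable (\<lambda>e. A e \<in> code_set (B e))"
proof -
  \<comment> \<open>The length of a list is at most its code, so \<open>c\<close> bounds the
    positions to be searched.\<close>
  have *: "x \<in> code_set c \<longleftrightarrow> (\<exists>i<c. \<not> (code_tl ^^ i) c = 0 \<and> code_hd ((code_tl ^^ i) c) = x)" for x c
  proof -
    have "x \<in> code_set c \<longleftrightarrow> (\<exists>i<length (list_decode c). code_hd ((code_tl ^^ i) c) = x)"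
      unfolding code_set_def in_set_conv_nth using code_hd_drop by metis
    also have "\<dots> \<longleftrightarrow> (\<exists>i<c. \<not> (code_tl ^^ i) c = 0 \<and> code_hd ((code_tl ^^ i) c) = x)"
      unfolding code_drop_eq_0 not_le using length_list_decode_le[of c] by (auto intro: order_less_le_trans)
    finally show ?thesis .
  qed
  have "decidable (\<lambda>e. e 0 \<in> code_set (e (Suc 0)))"
    unfolding *
    by (intro decidable_bex decidable_conj decidable_not decidable_eq
        computable_code_hd computable_code_drop computable_var computable_const)
  then show ?thesis
    unfolding decidable_def by (rule computable_subst2[OF _ assms])
qed

lemma decidable_code_set_bex:
  assumes "computable B" "decidable (\<lambda>e. P (e 0) (\<lambda>i. e (Suc i)))"
  shows "decidable (\<lambda>e. \<exists>c\<in>code_set (B e). P c e)"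
proof -
  have "decidable (\<lambda>e. \<exists>c<B e. c \<in> code_set (B e) \<and> P c e)"
    by (intro decidable_bex decidable_conj decidable_code_set computable_subst[OF assms(1)]
      computable_var assms)
  moreover have "(\<lambda>e. \<exists>c<B e. c \<in> code_set (B e) \<and> P c e) = (\<lambda>e. \<exists>c\<in>code_set (B e). P c e)"
    using code_set_less by (intro ext) blast
  ultimately show ?thesis by (simp only:)
qed

lemma decidable_code_set_ball:
  assumes "computable B" "decidable (\<lambda>e. P (e 0) (\<lambda>i. e (Suc i)))"
  shows "decidable (\<lambda>e. \<forall>c\<in>code_set (B e). P c e)"
proof -
  have "decidable (\<lambda>e. \<not> (\<exists>c\<in>code_set (B e). \<not> P c e))"
    by (intro decidable_not decidable_code_set_bex assms)
  then show ?thesis by simp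
qed

section \<open>Sides of walls\<close>

definition mat2_of :: "int \<Rightarrow> int \<Rightarrow> int \<Rightarrow> int \<Rightarrow> mat2" where
  "mat2_of a b c d = (\<chi> i j. if i = 1 then if j = 1 then a else b else if j = 1 then c else d)"

lemma mat2_of_nth [simp]:
  "mat2_of a b c d $ 1 $ 1 = a" "mat2_of a b c d $ 1 $ 2 = b"
  "mat2_of a b c d $ 2 $ 1 = c" "mat2_of a b c d $ 2 $ 2 = d"
  by (simp_all add: mat2_of_def)

lemma mat2_eq_iff:
  "(A :: mat2) = B \<longleftrightarrow> A $ 1 $ 1 = B $ 1 $ 1 \<and> A $ 1 $ 2 = B $ 1 $ 2 \<and>
     A $ 2 $ 1 = B $ 2 $ 1 \<and> A $ 2 $ 2 = B $ 2 $ 2"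
  by (simp add: vec_eq_iff forall_2)

lemma mat2_mult_nth [simp]: "((A :: mat2) ** B) $ i $ j = A $ i $ 1 * B $ 1 $ j + A $ i $ 2 * B $ 2 $ j"
  by (simp add: matrix_matrix_mult_def UNIV_2)

lemma mat2_one_nth [simp]:
  "(mat 1 :: mat2) $ 1 $ 1 = 1" "(mat 1 :: mat2) $ 1 $ 2 = 0"
  "(mat 1 :: mat2) $ 2 $ 1 = 0" "(mat 1 :: mat2) $ 2 $ 2 = 1"
  by (simp_all add: mat_def)

definition det2 :: "mat2 \<Rightarrow> int" where
  "det2 A = A $ 1 $ 1 * A $ 2 $ 2 - A $ 1 $ 2 * A $ 2 $ 1"

lemma det2_mult: "det2 (A ** B) = det2 A * det2 B"
  by (simp add: det2_def algebra_simps)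

lemma det2_one [simp]: "det2 (mat 1) = 1"
  by (simp add: det2_def)

definition unimodular :: "mat2 \<Rightarrow> bool" where
  "unimodular A \<longleftrightarrow> \<bar>det2 A\<bar> = 1"

lemma unimodular_one [simp]: "unimodular (mat 1)"
  by (simp add: unimodular_def)

lemma unimodular_mult: "unimodular A \<Longrightarrow> unimodular B \<Longrightarrow> unimodular (A ** B)"
  by (simp add: unimodular_def det2_mult abs_mult)

definition inv2 :: "mat2 \<Rightarrow> mat2" where
  "inv2 A = mat2_of (det2 A * A $ 2 $ 2) (- det2 A * A $ 1 $ 2) (- det2 A * A $ 2 $ 1) (det2 A * A $ 1 $ 1)"

lemma unimodular_det2_square: "unimodular A \<Longrightarrow> det2 A * det2 A = 1"
  unfolding unimodular_def by (metis abs_mult_self_eq mult_1)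

lemma inv2_right:
  assumes "unimodular A" shows "A ** inv2 A = mat 1"
proof -
  have "det2 A * (A $ 1 $ 1 * A $ 2 $ 2 - A $ 1 $ 2 * A $ 2 $ 1) = 1"
    using unimodular_det2_square[OF assms] by (simp add: det2_def)
  then show ?thesis
    unfolding mat2_eq_iff by (simp add: inv2_def algebra_simps)
qed

lemma inv2_left:
  assumes "unimodular A" shows "inv2 A ** A = mat 1"
proof -
  have "det2 A * (A $ 1 $ 1 * A $ 2 $ 2 - A $ 1 $ 2 * A $ 2 $ 1) = 1"
    using unimodular_det2_square[OF assms] by (simp add: det2_def)
  then show ?thesis
    unfolding mat2_eq_iff by (simp add: inv2_def algebra_simps)
qed

lemma unimodular_inv2:
  assumes "unimodular A" shows "unimodular (inv2 A)"
proof -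
  have "det2 A * det2 (inv2 A) = 1"
    using inv2_right[OF assms] det2_mult[of A "inv2 A"] by simp
  then show ?thesis
    using assms by (auto simp: unimodular_def abs_if split: if_splits)
qed

lemma inv2_cancel:
  assumes "unimodular A"
  shows "inv2 A ** (A ** B) = B" "A ** (inv2 A ** B) = B"
    "(B ** A) ** inv2 A = B" "(B ** inv2 A) ** A = B"
  using inv2_left[OF assms] inv2_right[OF assms]
  by (simp_all add: matrix_mul_assoc) (simp_all flip: matrix_mul_assoc)

text \<open>A column with entries p over q stands for the point p/q of the projective line. For
  unimodular \<open>A\<close> the columns are the ends of a Farey edge, and \<open>pos A\<close>
  places both in [0, infinity]; the edge W itself counts as lying on this side.\<close>

definition pos :: "mat2 \<Rightarrow> bool" where
  "pos A \<longleftrightarrow> 0 \<le> A $ 1 $ 1 * A $ 2 $ 1 \<and> 0 \<le> A $ 1 $ 2 * A $ 2 $ 2"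

lemma abs_diff_opposite_signs:
  fixes x y :: int
  assumes "x * y \<le> 0" shows "\<bar>x - y\<bar> = \<bar>x\<bar> + \<bar>y\<bar>"
  using assms by (auto simp: mult_le_0_iff)

text \<open>If one column product were positive and the other negative, then ad and bc would be
  nonzero of opposite signs and the determinant at least 2 in absolute value. So outside
  \<open>pos\<close> both ends lie in [-infinity, 0].\<close>

lemma not_posD:
  assumes "unimodular A" "\<not> pos A"
  shows "A $ 1 $ 1 * A $ 2 $ 1 \<le> 0" "A $ 1 $ 2 * A $ 2 $ 2 \<le> 0"
    "A $ 1 $ 1 * A $ 2 $ 1 < 0 \<or> A $ 1 $ 2 * A $ 2 $ 2 < 0"
proof -
  let ?a = "A $ 1 $ 1" and ?b = "A $ 1 $ 2" and ?c = "A $ 2 $ 1" and ?d = "A $ 2 $ 2"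
  show neg: "?a * ?c < 0 \<or> ?b * ?d < 0"
    using assms(2) by (auto simp: pos_def)
  have "\<not> (?a * ?c) * (?b * ?d) < 0"
  proof
    assume "(?a * ?c) * (?b * ?d) < 0"
    then have *: "(?a * ?d) * (?b * ?c) < 0" by (simp add: ac_simps)
    then have "?a * ?d \<noteq> 0" "?b * ?c \<noteq> 0" by auto
    then have "1 \<le> \<bar>?a * ?d\<bar>" "1 \<le> \<bar>?b * ?c\<bar>" by linarith+
    then show False
      using abs_diff_opposite_signs[of "?a * ?d" "?b * ?c"] * assms(1)
      by (simp add: unimodular_def det2_def)
  qed
  then have "?a * ?c \<le> 0 \<and> ?b * ?d \<le> 0"
    using neg mult_neg_pos[of "?a * ?c" "?b * ?d"] mult_pos_neg[of "?a * ?c" "?b * ?d"]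
    by linarith
  then show "?a * ?c \<le> 0" "?b * ?d \<le> 0"
    by blast+
qed

text \<open>A quadratic form in a column of \<open>A\<close>. Its outer coefficients are the column
  products of \<open>K\<close>, whose signs are controlled by \<open>pos K\<close>; only the mixed
  coefficient, called \<gamma> below, has to be matched with the column product of
  \<open>A\<close>.\<close>

lemma column_product:
  fixes K A :: mat2
  shows "(K ** A) $ 1 $ j * (K ** A) $ 2 $ j =
     K $ 1 $ 1 * K $ 2 $ 1 * (A $ 1 $ j)\<^sup>2 + K $ 1 $ 2 * K $ 2 $ 2 * (A $ 2 $ j)\<^sup>2 +
     (K $ 1 $ 1 * K $ 2 $ 2 + K $ 1 $ 2 * K $ 2 $ 1) * (A $ 1 $ j * A $ 2 $ j)"
  by (simp add: algebra_simps power2_eq_square)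

lemma pos_mult:
  assumes "pos K"
    and "0 \<le> (K $ 1 $ 1 * K $ 2 $ 2 + K $ 1 $ 2 * K $ 2 $ 1) * (A $ 1 $ 1 * A $ 2 $ 1)"
    and "0 \<le> (K $ 1 $ 1 * K $ 2 $ 2 + K $ 1 $ 2 * K $ 2 $ 1) * (A $ 1 $ 2 * A $ 2 $ 2)"
  shows "pos (K ** A)"
  using assms unfolding pos_def column_product by (auto intro!: add_nonneg_nonneg mult_nonneg_nonneg)

text \<open>All three terms of the quadratic form are nonpositive, so a nonnegative value makes the
  square terms vanish for both columns. As \<alpha> or \<beta> is negative, a row of
  \<open>A\<close> would be zero.\<close>

lemma not_pos_mult:
  assumes K: "unimodular K" "\<not> pos K" and A: "unimodular A"
    and u: "(K $ 1 $ 1 * K $ 2 $ 2 + K $ 1 $ 2 * K $ 2 $ 1) * (A $ 1 $ 1 * A $ 2 $ 1) \<le> 0"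
    and v: "(K $ 1 $ 1 * K $ 2 $ 2 + K $ 1 $ 2 * K $ 2 $ 1) * (A $ 1 $ 2 * A $ 2 $ 2) \<le> 0"
  shows "\<not> pos (K ** A)"
proof
  assume "pos (K ** A)"
  define \<alpha> where "\<alpha> = K $ 1 $ 1 * K $ 2 $ 1"
  define \<beta> where "\<beta> = K $ 1 $ 2 * K $ 2 $ 2"
  have *: "\<alpha> \<le> 0" "\<beta> \<le> 0" "\<alpha> < 0 \<or> \<beta> < 0"
    using not_posD[OF K] by (auto simp: \<alpha>_def \<beta>_def)
  have zero: "\<alpha> * x\<^sup>2 = 0 \<and> \<beta> * y\<^sup>2 = 0" if "0 \<le> \<alpha> * x\<^sup>2 + \<beta> * y\<^sup>2 + w" "w \<le> 0" for x y w
  proof -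
    have "\<alpha> * x\<^sup>2 \<le> 0" "\<beta> * y\<^sup>2 \<le> 0"
      using * by (auto intro: mult_nonpos_nonneg)
    with that show ?thesis by linarith
  qed
  have p: "0 \<le> \<alpha> * (A $ 1 $ j)\<^sup>2 + \<beta> * (A $ 2 $ j)\<^sup>2 +
      (K $ 1 $ 1 * K $ 2 $ 2 + K $ 1 $ 2 * K $ 2 $ 1) * (A $ 1 $ j * A $ 2 $ j)" if "j = 1 \<or> j = 2" for j
    using \<open>pos (K ** A)\<close> that unfolding pos_def column_product \<alpha>_def \<beta>_def by metis
  have "\<alpha> * (A $ 1 $ 1)\<^sup>2 = 0 \<and> \<beta> * (A $ 2 $ 1)\<^sup>2 = 0"
    "\<alpha> * (A $ 1 $ 2)\<^sup>2 = 0 \<and> \<beta> * (A $ 2 $ 2)\<^sup>2 = 0"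
    using zero[OF p u] zero[OF p v] by simp_all
  then show False
    using * A by (auto simp: unimodular_def det2_def)
qed

text \<open>Each cut of the family sits inside one side of every other one.\<close>

lemma pos_noncrossing:
  assumes K: "unimodular K" and "unimodular A" "unimodular B" "unimodular C" "unimodular D"
    and "pos A" "pos (K ** A)" "pos B" "\<not> pos (K ** B)"
    and "\<not> pos C" "pos (K ** C)" "\<not> pos D" "\<not> pos (K ** D)"
  shows False
proof -
  define \<gamma> where "\<gamma> = K $ 1 $ 1 * K $ 2 $ 2 + K $ 1 $ 2 * K $ 2 $ 1"
  note D = not_posD[OF \<open>unimodular C\<close> \<open>\<not> pos C\<close>] not_posD[OF \<open>unimodular D\<close> \<open>\<not> pos D\<close>]
  show False
  \<comment> \<open>The side of \<open>K\<close> and the sign of \<gamma> determine which of the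
    four combinations of sides is impossible.\<close>
  proof (cases "pos K"; cases "0 \<le> \<gamma>")
    assume "pos K" "0 \<le> \<gamma>"
    then have "pos (K ** B)"
      using \<open>pos B\<close> by (intro pos_mult) (auto simp: \<gamma>_def[symmetric] pos_def)
    then show False using assms by simp
  next
    assume "pos K" "\<not> 0 \<le> \<gamma>"
    then have "pos (K ** D)"
      using D by (intro pos_mult) (auto simp: \<gamma>_def[symmetric] intro: mult_nonpos_nonpos)
    then show False using assms by simp
  next
    assume "\<not> pos K" "0 \<le> \<gamma>"
    then have "\<not> pos (K ** C)"
      using D \<open>unimodular K\<close> \<open>unimodular C\<close>
      by (intro not_pos_mult) (auto simp: \<gamma>_def[symmetric] intro: mult_nonneg_nonpos)
    then show False using assms by simp
  next
    assume "\<not> pos K" "\<not> 0 \<le> \<gamma>"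
    then have "\<not> pos (K ** A)"
      using \<open>unimodular K\<close> \<open>unimodular A\<close> \<open>pos A\<close>
      by (intro not_pos_mult) (auto simp: \<gamma>_def[symmetric] pos_def intro: mult_nonpos_nonneg)
    then show False using assms by simp
  qed
qed

section \<open>Boxes that contain the separating walls\<close>

definition abs_sum :: "mat2 \<Rightarrow> int" where
  "abs_sum A = \<bar>A $ 1 $ 1\<bar> + \<bar>A $ 1 $ 2\<bar> + \<bar>A $ 2 $ 1\<bar> + \<bar>A $ 2 $ 2\<bar>"

definition box :: "int \<Rightarrow> mat2 set" where
  "box n = {A. \<bar>A $ 1 $ 1\<bar> \<le> n \<and> \<bar>A $ 1 $ 2\<bar> \<le> n \<and> \<bar>A $ 2 $ 1\<bar> \<le> n \<and> \<bar>A $ 2 $ 2\<bar> \<le> n}"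

lemma box_eq: "box n = (\<lambda>(a, b, c, d). mat2_of a b c d) ` ({-n..n} \<times> {-n..n} \<times> {-n..n} \<times> {-n..n})"
proof (intro equalityI subsetI)
  fix A assume "A \<in> box n"
  then show "A \<in> (\<lambda>(a, b, c, d). mat2_of a b c d) ` ({-n..n} \<times> {-n..n} \<times> {-n..n} \<times> {-n..n})"
    by (intro image_eqI[of _ _ "(A $ 1 $ 1, A $ 1 $ 2, A $ 2 $ 1, A $ 2 $ 2)"])
      (auto simp: mat2_eq_iff box_def)
qed (auto simp: box_def)

lemma finite_box: "finite (box n)"
  unfolding box_eq by simp

lemma card_box_le: "card (box n) \<le> nat (2 * n + 1) ^ 4"
proof -
  have "card (box n) \<le> card ({-n..n} \<times> {-n..n} \<times> {-n..n} \<times> {-n..n})"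
    unfolding box_eq by (rule card_image_le) simp
  also have "\<dots> = nat (2 * n + 1) ^ 4"
    by (simp add: card_cartesian_product power4_eq_xxxx mult.assoc algebra_simps)
  finally show ?thesis .
qed

lemma mem_box_abs_sum: "abs_sum A \<le> n \<Longrightarrow> A \<in> box n"
  unfolding abs_sum_def box_def by auto

text \<open>No cancellation occurs in \<open>G = K\<inverse> ** (K ** G)\<close>, because the
  columns of the two factors lie in opposite quadrants.\<close>

lemma separating_in_box:
  assumes K: "unimodular K" and G: "unimodular G" and sep: "pos K \<noteq> pos (K ** G)"
  shows "K \<in> box (abs_sum G)"
proof -
  define L where "L = K ** G"
  define a b c d where "a = K $ 1 $ 1" and "b = K $ 1 $ 2" and "c = K $ 2 $ 1" and "d = K $ 2 $ 2"
  define a' b' c' d' where "a' = L $ 1 $ 1" and "b' = L $ 1 $ 2" and "c' = L $ 2 $ 1" and "d' = L $ 2 $ 2"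
  note defs = a_def b_def c_def d_def a'_def b'_def c'_def d'_def
  have L: "unimodular L" unfolding L_def using K G by (rule unimodular_mult)
  have ac: "0 \<le> a * c \<and> 0 \<le> b * d \<and> a' * c' \<le> 0 \<and> b' * d' \<le> 0 \<or>
    a * c \<le> 0 \<and> b * d \<le> 0 \<and> 0 \<le> a' * c' \<and> 0 \<le> b' * d'"
    using sep not_posD[OF K] not_posD[OF L] unfolding L_def[symmetric] defs pos_def by auto
  have G_eq: "G = inv2 K ** L"
    unfolding L_def using inv2_cancel[OF K] by simp
  have abs1: "\<bar>det2 K * x\<bar> = \<bar>x\<bar>" for x
    using K by (simp add: unimodular_def abs_mult)
  have opp: "(d * a') * (b * c') \<le> 0" "(d * b') * (b * d') \<le> 0"
    "(a * c') * (c * a') \<le> 0" "(a * d') * (c * b') \<le> 0"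
  proof -
    have "(b * d) * (a' * c') \<le> 0" "(b * d) * (b' * d') \<le> 0"
      "(a * c) * (a' * c') \<le> 0" "(a * c) * (b' * d') \<le> 0"
      using ac by (auto intro: mult_nonneg_nonpos mult_nonpos_nonneg)
    then show "(d * a') * (b * c') \<le> 0" "(d * b') * (b * d') \<le> 0"
      "(a * c') * (c * a') \<le> 0" "(a * d') * (c * b') \<le> 0"
      by (simp_all add: ac_simps)
  qed
  have "G $ 1 $ 1 = det2 K * (d * a' - b * c')" "G $ 1 $ 2 = det2 K * (d * b' - b * d')"
    "G $ 2 $ 1 = det2 K * (a * c' - c * a')" "G $ 2 $ 2 = det2 K * (a * d' - c * b')"
    unfolding G_eq by (simp_all add: inv2_def defs algebra_simps)
  then have G_abs: "\<bar>G $ 1 $ 1\<bar> = \<bar>d\<bar> * \<bar>a'\<bar> + \<bar>b\<bar> * \<bar>c'\<bar>" "\<bar>G $ 1 $ 2\<bar> = \<bar>d\<bar> * \<bar>b'\<bar> + \<bar>b\<bar> * \<bar>d'\<bar>"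
    "\<bar>G $ 2 $ 1\<bar> = \<bar>a\<bar> * \<bar>c'\<bar> + \<bar>c\<bar> * \<bar>a'\<bar>" "\<bar>G $ 2 $ 2\<bar> = \<bar>a\<bar> * \<bar>d'\<bar> + \<bar>c\<bar> * \<bar>b'\<bar>"
    by (simp_all only: abs1 abs_diff_opposite_signs[OF opp(1)] abs_diff_opposite_signs[OF opp(2)]
        abs_diff_opposite_signs[OF opp(3)] abs_diff_opposite_signs[OF opp(4)]) (simp_all add: abs_mult)
  have rows: "1 \<le> \<bar>a'\<bar> + \<bar>b'\<bar>" "1 \<le> \<bar>c'\<bar> + \<bar>d'\<bar>"
  proof -
    have "a' \<noteq> 0 \<or> b' \<noteq> 0" "c' \<noteq> 0 \<or> d' \<noteq> 0"
      using L by (auto simp: unimodular_def det2_def a'_def b'_def c'_def d'_def)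
    then show "1 \<le> \<bar>a'\<bar> + \<bar>b'\<bar>" "1 \<le> \<bar>c'\<bar> + \<bar>d'\<bar>" by linarith+
  qed
  \<comment> \<open>In \<open>G_abs\<close> each entry of \<open>K\<close> is multiplied by both
    entries of one row of \<open>L\<close>. That row is nonzero, so the entry is bounded by the sum
    of a row of \<open>G\<close>, in absolute values.\<close>
  have bound: "x \<le> (x * u + y * w) + (x * v + y * z)" "x \<le> (y * w + x * u) + (y * z + x * v)"
    if "0 \<le> x" "0 \<le> y" "0 \<le> w" "0 \<le> z" "1 \<le> u + v" for x y u v w z :: int
  proof -
    have "x \<le> x * (u + v)"
      using mult_left_mono[OF that(5,1)] by simp
    moreover have "0 \<le> y * w" "0 \<le> y * z"
      using that by simp_all
    ultimately show "x \<le> (x * u + y * w) + (x * v + y * z)" "x \<le> (y * w + x * u) + (y * z + x * v)"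
      unfolding distrib_left by linarith+
  qed
  have "\<bar>d\<bar> \<le> \<bar>G $ 1 $ 1\<bar> + \<bar>G $ 1 $ 2\<bar>" "\<bar>b\<bar> \<le> \<bar>G $ 1 $ 1\<bar> + \<bar>G $ 1 $ 2\<bar>"
    "\<bar>c\<bar> \<le> \<bar>G $ 2 $ 1\<bar> + \<bar>G $ 2 $ 2\<bar>" "\<bar>a\<bar> \<le> \<bar>G $ 2 $ 1\<bar> + \<bar>G $ 2 $ 2\<bar>"
    unfolding G_abs by (rule bound; simp add: rows)+
  then show ?thesis
    unfolding box_def abs_sum_def mem_Collect_eq a_def[symmetric] b_def[symmetric] c_def[symmetric] d_def[symmetric]
    by (auto intro: order_trans)
qed

section \<open>The wall metric\<close>

text \<open>\<open>K\<close> stands for the wall K^-1 W. Different \<open>K\<close> can name the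
  same cut, for example \<open>K\<close> and \<open>- K\<close>, so cuts are counted with
  multiplicity. Elements with the same edge, such as \<open>A\<close> and \<open>- A\<close>, are at
  distance 0.\<close>

definition separators :: "mat2 \<Rightarrow> mat2 \<Rightarrow> mat2 set" where
  "separators A B = {K. unimodular K \<and> pos (K ** A) \<noteq> pos (K ** B)}"

definition wall_dist :: "mat2 \<Rightarrow> mat2 \<Rightarrow> nat" where
  "wall_dist A B = card (separators A B)"

lemma separators_one: "unimodular A \<Longrightarrow> separators (mat 1) A \<subseteq> box (abs_sum A)"
  using separating_in_box by (auto simp: separators_def)

lemma finite_separators:
  assumes "unimodular A" "unimodular B" shows "finite (separators A B)"
proof (rule finite_subset)
  show "separators A B \<subseteq> separators (mat 1) A \<union> separators (mat 1) B"
    by (auto simp: separators_def)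
  show "finite (separators (mat 1) A \<union> separators (mat 1) B)"
    using assms by (blast intro: finite_subset[OF separators_one finite_box])
qed

text \<open>Right translation by \<open>G\<close> is a bijection between the two sets of separating
  matrices, which gives left invariance of the distance.\<close>

lemma separators_mult_left:
  assumes "unimodular G"
  shows "separators A B = (\<lambda>K. K ** G) ` separators (G ** A) (G ** B)"
proof (intro equalityI subsetI)
  fix K assume "K \<in> separators A B"
  then show "K \<in> (\<lambda>K. K ** G) ` separators (G ** A) (G ** B)"
    using assms
    by (intro image_eqI[of _ _ "K ** inv2 G"])
      (simp_all add: separators_def unimodular_mult unimodular_inv2 inv2_cancel inv2_left flip: matrix_mul_assoc)
qed (use assms in \<open>auto simp: separators_def unimodular_mult matrix_mul_assoc\<close>)

lemma wall_dist_mult_left: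
  assumes "unimodular G" shows "wall_dist (G ** A) (G ** B) = wall_dist A B"
proof -
  have "inj_on (\<lambda>K. K ** G) S" for S :: "mat2 set"
    by (rule inj_on_inverseI[of _ "\<lambda>K. K ** inv2 G"]) (simp add: inv2_cancel assms)
  then show ?thesis
    unfolding wall_dist_def separators_mult_left[OF assms, of A B] by (simp add: card_image)
qed

text \<open>Writing distances as sums over one common finite set lets inequalities between them be
  proved wall by wall.\<close>

lemma wall_dist_sum:
  assumes "finite S" "separators A B \<subseteq> S" "S \<subseteq> Collect unimodular"
  shows "wall_dist A B = (\<Sum>K\<in>S. of_bool (pos (K ** A) \<noteq> pos (K ** B)))"
proof -
  have "separators A B = {K\<in>S. pos (K ** A) \<noteq> pos (K ** B)}"
    using assms by (auto simp: separators_def)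
  then show ?thesis
    using assms(1) by (simp add: wall_dist_def Int_def)
qed

lemma wall_dist_commute: "wall_dist A B = wall_dist B A"
  by (simp add: wall_dist_def separators_def eq_commute)

text \<open>At a single wall, the left side exceeds the second sum only if the wall splits the
  points as XP | YZ, and the first sum only if it splits them as XY | ZP. Two such walls would
  cross, so at most one of these kinds occurs.\<close>

lemma wall_dist_four_point:
  assumes "unimodular X" "unimodular Y" "unimodular Z" "unimodular P"
  shows "wall_dist X Z + wall_dist Y P \<le> max (wall_dist X Y + wall_dist Z P) (wall_dist Y Z + wall_dist X P)"
proof -
  define S where "S = separators X Y \<union> separators X Z \<union> separators X P \<union> separators Y Z \<union> separators Y P \<union> separators Z P"
  have "finite S"
    unfolding S_def using assms by (simp add: finite_separators)
  moreover have "S \<subseteq> Collect unimodular"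
    by (auto simp: S_def separators_def)
  moreover have "separators X Y \<subseteq> S" "separators X Z \<subseteq> S" "separators X P \<subseteq> S"
    "separators Y Z \<subseteq> S" "separators Y P \<subseteq> S" "separators Z P \<subseteq> S"
    by (auto simp: S_def)
  ultimately have sums:
    "wall_dist X Y = (\<Sum>K\<in>S. of_bool (pos (K ** X) \<noteq> pos (K ** Y)))"
    "wall_dist X Z = (\<Sum>K\<in>S. of_bool (pos (K ** X) \<noteq> pos (K ** Z)))"
    "wall_dist X P = (\<Sum>K\<in>S. of_bool (pos (K ** X) \<noteq> pos (K ** P)))"
    "wall_dist Y Z = (\<Sum>K\<in>S. of_bool (pos (K ** Y) \<noteq> pos (K ** Z)))"
    "wall_dist Y P = (\<Sum>K\<in>S. of_bool (pos (K ** Y) \<noteq> pos (K ** P)))"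
    "wall_dist Z P = (\<Sum>K\<in>S. of_bool (pos (K ** Z) \<noteq> pos (K ** P)))"
    by - (rule wall_dist_sum; assumption)+
  have unimod: "unimodular K" if "K \<in> S" for K
    using that by (auto simp: S_def separators_def)
  show ?thesis
  proof (cases "\<exists>K\<in>S. pos (K ** X) = pos (K ** P) \<and> pos (K ** Y) = pos (K ** Z) \<and> pos (K ** X) \<noteq> pos (K ** Y)")
    case False
    have "wall_dist X Z + wall_dist Y P \<le> wall_dist Y Z + wall_dist X P"
      unfolding sums sum.distrib[symmetric] using False by (intro sum_mono) (auto simp: of_bool_def)
    then show ?thesis by simp
  next
    case True
    then obtain K where K: "K \<in> S" "pos (K ** X) = pos (K ** P)" "pos (K ** Y) = pos (K ** Z)"
      "pos (K ** X) \<noteq> pos (K ** Y)" by blast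
    have no: False if L: "L \<in> S" "pos (L ** X) = pos (L ** Y)" "pos (L ** Z) = pos (L ** P)"
      "pos (L ** X) \<noteq> pos (L ** Z)" for L
    proof -
      \<comment> \<open>In coordinates where \<open>K\<close> becomes the identity, the second wall
        is given by \<open>M\<close>.\<close>
      define M where "M = L ** inv2 K"
      have M: "unimodular M" "M ** (K ** A) = L ** A" for A :: mat2
        using unimod[OF K(1)] unimod[OF L(1)]
        by (simp_all add: M_def unimodular_mult unimodular_inv2 inv2_cancel flip: matrix_mul_assoc)
      note nc = pos_noncrossing[OF M(1), of "K ** _" "K ** _" "K ** _" "K ** _", unfolded M(2)]
      have um: "unimodular (K ** X)" "unimodular (K ** Y)" "unimodular (K ** Z)" "unimodular (K ** P)"
        using unimod[OF K(1)] assms by (simp_all add: unimodular_mult)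
      \<comment> \<open>The four points realise all four combinations of sides; which point takes
        which role depends on the side of \<open>X\<close> at each wall.\<close>
      show False
        using nc[of X P Y Z] nc[of P X Z Y] nc[of Y Z X P] nc[of Z Y P X] um K L by metis
    qed
    have "wall_dist X Z + wall_dist Y P \<le> wall_dist X Y + wall_dist Z P"
      unfolding sums sum.distrib[symmetric] using no by (intro sum_mono) (auto simp: of_bool_def)
    then show ?thesis by simp
  qed
qed

text \<open>The conjunct \<open>unimodular A\<close> gives singular matrices length 0, so that in a
  singular group every product passes the length test.\<close>

definition wall_len :: "mat2 \<Rightarrow> nat" where
  "wall_len A = card {K. unimodular K \<and> unimodular A \<and> pos K \<noteq> pos (K ** A)}"

lemma wall_len_eq: "unimodular A \<Longrightarrow> wall_len A = wall_dist (mat 1) A"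
  by (simp add: wall_len_def wall_dist_def separators_def)

lemma wall_len_not_unimodular: "\<not> unimodular A \<Longrightarrow> wall_len A = 0"
  by (simp add: wall_len_def)

lemma wall_len_le_abs_sum: "wall_len A \<le> nat (2 * abs_sum A + 1) ^ 4"
proof (cases "unimodular A")
  case True
  then have "wall_len A \<le> card (box (abs_sum A))"
    unfolding wall_len_eq[OF True] wall_dist_def
    by (intro card_mono finite_box separators_one)
  then show ?thesis using card_box_le[of "abs_sum A"] by linarith
qed (simp add: wall_len_not_unimodular)

section \<open>Properness: the length bounds the entries\<close>

definition nonneg :: "mat2 \<Rightarrow> bool" where
  "nonneg A \<longleftrightarrow> 0 \<le> A $ 1 $ 1 \<and> 0 \<le> A $ 1 $ 2 \<and> 0 \<le> A $ 2 $ 1 \<and> 0 \<le> A $ 2 $ 2"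

lemma nonneg_pos: "nonneg A \<Longrightarrow> pos A"
  by (simp add: nonneg_def pos_def)

text \<open>One step of the Euclidean algorithm crosses a wall.\<close>

lemma wall_len_elementary_mult:
  assumes E: "E = mat2_of 1 1 0 1 \<or> E = mat2_of 1 0 1 1" and A: "unimodular A" "nonneg A"
  shows "wall_len A < wall_len (E ** A)"
proof -
  have unimod: "unimodular E"
    using E by (auto simp: unimodular_def det2_def)
  have inv_E: "inv2 E = mat2_of 1 (-1) 0 1 \<or> inv2 E = mat2_of 1 0 (-1) 1"
    using E by (auto simp: inv2_def det2_def mat2_eq_iff)
  have A_col: "0 \<le> A $ 1 $ 1 * A $ 2 $ 1" "0 \<le> A $ 1 $ 2 * A $ 2 $ 2"
    using A(2) by (simp_all add: nonneg_def)
  \<comment> \<open>A wall separating 1 from \<open>A\<close> has 1 and \<open>inv2 E\<close> on the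
    same side, hence also separates \<open>inv2 E\<close> from \<open>A\<close>.\<close>
  have pos_inv: "pos (K ** inv2 E) = pos K" if K: "unimodular K" "pos K \<noteq> pos (K ** A)" for K
  proof -
    define \<gamma> where "\<gamma> = K $ 1 $ 1 * K $ 2 $ 2 + K $ 1 $ 2 * K $ 2 $ 1"
    \<comment> \<open>The product of the one column of \<open>K ** inv2 E\<close> that differs from
      the column of \<open>K\<close>. The sign forced upon \<gamma> keeps it on the side of
      \<open>K\<close>.\<close>
    have diff: "(K $ 1 $ 2 - K $ 1 $ 1) * (K $ 2 $ 2 - K $ 2 $ 1) =
        K $ 1 $ 1 * K $ 2 $ 1 + K $ 1 $ 2 * K $ 2 $ 2 - \<gamma>"
      "(K $ 1 $ 1 - K $ 1 $ 2) * (K $ 2 $ 1 - K $ 2 $ 2) =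
        K $ 1 $ 1 * K $ 2 $ 1 + K $ 1 $ 2 * K $ 2 $ 2 - \<gamma>"
      by (simp_all add: \<gamma>_def algebra_simps)
    show ?thesis
    proof (cases "pos K")
      case True
      then have "\<gamma> < 0"
        using K(2) pos_mult[OF True, of A, folded \<gamma>_def] A_col by (meson mult_nonneg_nonneg not_less)
      with True inv_E show ?thesis
        by (auto simp: pos_def diff)
    next
      case False
      then have "0 < \<gamma>"
        using K(2) not_pos_mult[OF K(1) False A(1), folded \<gamma>_def] A_col
        by (meson mult_nonpos_nonneg not_less)
      with False inv_E not_posD[OF K(1) False] show ?thesis
        by (auto simp: pos_def diff)
    qed
  qed
  have "separators (mat 1) A \<subset> separators (inv2 E) A"
  proof (rule psubsetI)
    show "separators (mat 1) A \<subseteq> separators (inv2 E) A"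
      using pos_inv by (auto simp: separators_def)
    have "\<not> pos (inv2 E)" using inv_E by (auto simp: pos_def)
    \<comment> \<open>The additional wall is W itself, named by the identity.\<close>
    then have "mat 1 \<in> separators (inv2 E) A"
      using nonneg_pos[OF A(2)] by (simp add: separators_def)
    moreover have "mat 1 \<notin> separators (mat 1) A"
      using nonneg_pos[OF A(2)] by (simp add: separators_def pos_def)
    ultimately show "separators (mat 1) A \<noteq> separators (inv2 E) A" by metis
  qed
  then have "wall_dist (mat 1) A < wall_dist (inv2 E) A"
    unfolding wall_dist_def
    by (intro psubset_card_mono finite_separators unimodular_inv2 unimod A)
  also have "\<dots> = wall_dist (mat 1) (E ** A)"
    using wall_dist_mult_left[OF unimod, of "inv2 E" A] by (simp add: inv2_right unimod)
  finally show ?thesis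
    using wall_len_eq A(1) unimodular_mult[OF unimod A(1)] by simp
qed

text \<open>Euclidean algorithm on the rows: if one row dominates the other, subtracting the smaller
  one loses at most half of \<open>abs_sum\<close> and at least one unit of \<open>wall_len\<close>.
  Otherwise the determinant leaves only the two permutation matrices.\<close>

lemma abs_sum_le_wall_len_nonneg:
  assumes "unimodular A" "nonneg A"
  shows "abs_sum A \<le> 2 * 2 ^ wall_len A"
  using assms
proof (induction "nat (abs_sum A)" arbitrary: A rule: less_induct)
  case less
  let ?a = "A $ 1 $ 1" and ?b = "A $ 1 $ 2" and ?c = "A $ 2 $ 1" and ?d = "A $ 2 $ 2"
  have nn: "0 \<le> ?a" "0 \<le> ?b" "0 \<le> ?c" "0 \<le> ?d"
    using less.prems by (simp_all add: nonneg_def)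
  have det: "\<bar>?a * ?d - ?b * ?c\<bar> = 1"
    using less.prems by (simp add: unimodular_def det2_def)
  have step: ?case if E: "E = mat2_of 1 1 0 1 \<or> E = mat2_of 1 0 1 1" and B: "A = E ** B"
    "unimodular B" "nonneg B" "abs_sum B < abs_sum A" for E B
  proof -
    have "0 \<le> abs_sum B" by (simp add: abs_sum_def)
    then have "abs_sum B \<le> 2 * 2 ^ wall_len B"
      using less.hyps[of B] B by simp
    moreover have "abs_sum A \<le> 2 * abs_sum B"
      using E B(3) unfolding B(1) by (auto simp: abs_sum_def nonneg_def)
    moreover have "2 ^ Suc (wall_len B) \<le> (2 :: int) ^ wall_len A"
      using wall_len_elementary_mult[OF E B(2,3)] unfolding B(1)[symmetric]
      by (intro power_increasing) auto
    ultimately show ?thesis by simp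
  qed
  have row_nonzero: "0 < ?a + ?b" "0 < ?c + ?d"
  proof -
    have "?a \<noteq> 0 \<or> ?b \<noteq> 0" "?c \<noteq> 0 \<or> ?d \<noteq> 0" using det by auto
    then show "0 < ?a + ?b" "0 < ?c + ?d" using nn by linarith+
  qed
  consider "?c \<le> ?a" "?d \<le> ?b" | "?a \<le> ?c" "?b \<le> ?d" | "?c < ?a" "?b < ?d" | "?a < ?c" "?d < ?b"
    by linarith
  then show ?case
  proof cases
    case 1
    show ?thesis
    proof (rule step)
      show "A = mat2_of 1 1 0 1 ** mat2_of (?a - ?c) (?b - ?d) ?c ?d"
        by (simp add: mat2_eq_iff)
      show "unimodular (mat2_of (?a - ?c) (?b - ?d) ?c ?d)"
        using det by (simp add: unimodular_def det2_def algebra_simps)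
      show "nonneg (mat2_of (?a - ?c) (?b - ?d) ?c ?d)"
        using 1 nn by (simp add: nonneg_def)
      show "abs_sum (mat2_of (?a - ?c) (?b - ?d) ?c ?d) < abs_sum A"
        using 1 nn row_nonzero by (simp add: abs_sum_def)
    qed simp
  next
    case 2
    show ?thesis
    proof (rule step)
      show "A = mat2_of 1 0 1 1 ** mat2_of ?a ?b (?c - ?a) (?d - ?b)"
        by (simp add: mat2_eq_iff)
      show "unimodular (mat2_of ?a ?b (?c - ?a) (?d - ?b))"
        using det by (simp add: unimodular_def det2_def algebra_simps)
      show "nonneg (mat2_of ?a ?b (?c - ?a) (?d - ?b))"
        using 2 nn by (simp add: nonneg_def)
      show "abs_sum (mat2_of ?a ?b (?c - ?a) (?d - ?b)) < abs_sum A"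
        using 2 nn row_nonzero by (simp add: abs_sum_def)
    qed simp
  next
    case 3
    \<comment> \<open>Rows crossing in this way make the determinant at least b + c + 1, so b = c =
      0.\<close>
    have "(?c + 1) * (?b + 1) \<le> ?a * ?d"
      using 3 nn by (intro mult_mono) auto
    then have "?b + ?c + 1 \<le> ?a * ?d - ?b * ?c"
      by (simp add: algebra_simps)
    then have "?b = 0 \<and> ?c = 0" using det nn by linarith
    then have "?b = 0" "?c = 0" by simp_all
    then have "\<bar>?a * ?d\<bar> = 1" using det by simp
    then have "\<bar>?a\<bar> = 1" "\<bar>?d\<bar> = 1" by (metis abs_zmult_eq_1 mult.commute)+
    then have "abs_sum A = 2 * 1" using \<open>?b = 0\<close> \<open>?c = 0\<close> by (simp add: abs_sum_def)
    also have "\<dots> \<le> 2 * 2 ^ wall_len A" by (intro mult_left_mono) auto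
    finally show ?thesis .
  next
    case 4
    have "(?a + 1) * (?d + 1) \<le> ?c * ?b"
      using 4 nn by (intro mult_mono) auto
    then have "?a + ?d + 1 \<le> ?b * ?c - ?a * ?d"
      by (simp add: algebra_simps)
    then have "?a = 0 \<and> ?d = 0" using det nn by linarith
    then have "?a = 0" "?d = 0" by simp_all
    then have "\<bar>?b * ?c\<bar> = 1" using det by simp
    then have "\<bar>?b\<bar> = 1" "\<bar>?c\<bar> = 1" by (metis abs_zmult_eq_1 mult.commute)+
    then have "abs_sum A = 2 * 1" using \<open>?a = 0\<close> \<open>?d = 0\<close> by (simp add: abs_sum_def)
    also have "\<dots> \<le> 2 * 2 ^ wall_len A" by (intro mult_left_mono) auto
    finally show ?thesis .
  qed
qed

text \<open>Sign changes of columns preserve \<open>pos\<close>. On the left, the sign matrix acts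
  as an isometry, and no wall separates it from the identity.\<close>

lemma wall_len_sign_change:
  assumes s: "s = 1 \<or> s = -1" and t: "t = 1 \<or> t = -1" "u = 1 \<or> u = -1" and A: "unimodular A"
  shows "wall_len (mat2_of 1 0 0 s ** A ** mat2_of t 0 0 u) = wall_len A"
proof -
  let ?S = "mat2_of 1 0 0 s" and ?T = "mat2_of t 0 0 u"
  have unimod: "unimodular ?S" "unimodular ?T"
    using s t by (auto simp: unimodular_def det2_def)
  have pos_S: "pos (K ** ?S) = pos K" for K
    using s by (auto simp: pos_def)
  have pos_T: "pos (K ** ?T) = pos K" for K
    using t by (auto simp: pos_def)
  have "?S ** ?S = mat 1"
    using s by (auto simp: mat2_eq_iff)
  then have "wall_dist (mat 1) (?S ** A ** ?T) = wall_dist ?S (A ** ?T)"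
    using wall_dist_mult_left[OF unimod(1), of ?S "A ** ?T"] by (simp add: matrix_mul_assoc)
  also have "\<dots> = wall_dist (mat 1) A"
    by (simp add: wall_dist_def separators_def matrix_mul_assoc pos_S pos_T)
  finally show ?thesis
    using wall_len_eq A unimod by (simp add: unimodular_mult)
qed

text \<open>\<open>s\<close> moves both columns to the side \<open>pos\<close>; then no column has
  entries of opposite signs, and \<open>t\<close> and \<open>u\<close> make the columns
  nonnegative.\<close>

lemma sign_change_nonneg:
  assumes A: "unimodular A"
  obtains s t u where "s = 1 \<or> s = -1" "t = 1 \<or> t = -1" "u = 1 \<or> u = -1"
    "nonneg (mat2_of 1 0 0 s ** A ** mat2_of t 0 0 u)"
proof -
  define s :: int where "s = (if pos A then 1 else -1)"
  have cols: "0 \<le> A $ 1 $ 1 * (s * A $ 2 $ 1)" "0 \<le> A $ 1 $ 2 * (s * A $ 2 $ 2)"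
    using not_posD(1,2)[OF A] by (auto simp: s_def pos_def)
  have ex: "\<exists>t. (t = 1 \<or> t = -1) \<and> 0 \<le> x * t \<and> 0 \<le> y * t" if "0 \<le> x * y" for x y :: int
  proof (cases "0 \<le> x \<and> 0 \<le> y")
    case False
    then have "x \<le> 0 \<and> y \<le> 0" using that by (auto simp: zero_le_mult_iff)
    then show ?thesis by (intro exI[of _ "-1"]) auto
  qed (intro exI[of _ 1], auto)
  obtain t where t: "t = 1 \<or> t = -1" "0 \<le> A $ 1 $ 1 * t" "0 \<le> s * A $ 2 $ 1 * t"
    using ex[OF cols(1)] by blast
  obtain u where u: "u = 1 \<or> u = -1" "0 \<le> A $ 1 $ 2 * u" "0 \<le> s * A $ 2 $ 2 * u"
    using ex[OF cols(2)] by blast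
  show thesis
    using t u by (intro that[of s t u]) (auto simp: nonneg_def s_def)
qed

text \<open>After normalising signs, the exponential bound confines the entries to a box. This keeps
  the certificates of non-membership finite.\<close>

lemma finite_wall_len_ball: "finite {A. unimodular A \<and> wall_len A \<le> n}"
proof (rule finite_subset)
  show "{A. unimodular A \<and> wall_len A \<le> n} \<subseteq> box (2 * 2 ^ n)"
  proof
    fix A assume "A \<in> {A. unimodular A \<and> wall_len A \<le> n}"
    then have A: "unimodular A" "wall_len A \<le> n" by auto
    obtain s t u where stu: "s = 1 \<or> s = -1" "t = 1 \<or> t = -1" "u = 1 \<or> u = -1"
      and nonneg: "nonneg (mat2_of 1 0 0 s ** A ** mat2_of t 0 0 u)"
      using sign_change_nonneg[OF A(1)] by blast
    let ?B = "mat2_of 1 0 0 s ** A ** mat2_of t 0 0 u"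
    have "unimodular ?B"
      using stu A(1) by (intro unimodular_mult) (auto simp: unimodular_def det2_def)
    then have "abs_sum ?B \<le> 2 * 2 ^ wall_len A"
      using abs_sum_le_wall_len_nonneg nonneg wall_len_sign_change[OF stu A(1)] by metis
    moreover have "abs_sum ?B = abs_sum A"
      using stu by (auto simp: abs_sum_def)
    moreover have "(2 :: int) ^ wall_len A \<le> 2 ^ n"
      using A(2) by (intro power_increasing) auto
    ultimately show "A \<in> box (2 * 2 ^ n)"
      by (intro mem_box_abs_sum) linarith
  qed
qed (rule finite_box)

section \<open>Words over locally closed sets\<close>

definition mat_prod :: "mat2 list \<Rightarrow> mat2" where
  "mat_prod As = foldr (**) As (mat 1)"

lemma mat_prod_simps [simp]: "mat_prod [] = mat 1" "mat_prod (A # As) = A ** mat_prod As"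
  by (simp_all add: mat_prod_def)

lemma mat_prod_append: "mat_prod (As @ Bs) = mat_prod As ** mat_prod Bs"
  by (induction As) (simp_all add: matrix_mul_assoc)

lemma unimodular_mat_prod: "\<forall>A\<in>set As. unimodular A \<Longrightarrow> unimodular (mat_prod As)"
  by (induction As) (simp_all add: unimodular_mult)

text \<open>The four-point condition for \<open>X\<close>, \<open>X ** A\<close>,
  \<open>X ** A ** B\<close> and the identity bounds |AB| + |XA| by the larger of |A| + |XAB| and
  |B| + |X|. Both are at most N + |XA|, as \<open>X ** A\<close> is the longest of the three
  prefixes.\<close>

lemma wall_len_mult_four_point:
  assumes "unimodular X" "unimodular A" "unimodular B"
    and "wall_len A \<le> N" "wall_len B \<le> N"
    and "wall_len X \<le> wall_len (X ** A)" "wall_len (X ** A ** B) \<le> wall_len (X ** A)"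
  shows "wall_len (A ** B) \<le> N"
proof -
  have um: "unimodular (X ** A)" "unimodular (X ** A ** B)" "unimodular (A ** B)"
    using assms by (simp_all add: unimodular_mult)
  have "wall_dist X (X ** A) = wall_len A"
    using wall_dist_mult_left[OF assms(1), of "mat 1" A] wall_len_eq[OF assms(2)] by simp
  moreover have "wall_dist (X ** A) (X ** A ** B) = wall_len B"
    using wall_dist_mult_left[OF um(1), of "mat 1" B] wall_len_eq[OF assms(3)] by simp
  moreover have "wall_dist X (X ** A ** B) = wall_len (A ** B)"
    using wall_dist_mult_left[OF assms(1), of "mat 1" "A ** B"] wall_len_eq[OF um(3)]
    by (simp add: matrix_mul_assoc)
  moreover have "wall_dist Y (mat 1) = wall_len Y" if "unimodular Y" for Y
    using wall_dist_commute wall_len_eq[OF that] by simp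
  ultimately show ?thesis
    using wall_dist_four_point[OF assms(1) um(1,2) unimodular_one] assms um by (simp add: max_def split: if_splits)
qed

text \<open>A word with at least two letters can be shortened at a prefix of maximal length, because
  the four-point condition bounds the product of the two letters adjacent to it.\<close>

lemma mat_prod_mem_locally_closed:
  assumes R: "\<And>A. A \<in> R \<Longrightarrow> unimodular A \<and> wall_len A \<le> N"
    and closed: "\<And>A B. A \<in> R \<Longrightarrow> B \<in> R \<Longrightarrow> wall_len (A ** B) \<le> N \<Longrightarrow> A ** B \<in> R"
  shows "As \<noteq> [] \<Longrightarrow> set As \<subseteq> R \<Longrightarrow> wall_len (mat_prod As) \<le> N \<Longrightarrow> mat_prod As \<in> R"
proof (induction "length As" arbitrary: As rule: less_induct)
  case less
  define f where "f i = wall_len (mat_prod (take i As))" for i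
  have shorten: ?case if "As = Us @ A # B # Vs" "wall_len (A ** B) \<le> N" for Us A B Vs
  proof -
    have "mat_prod (Us @ (A ** B) # Vs) \<in> R"
      using that less.prems closed[of A B]
      by (intro less.hyps) (auto simp: mat_prod_append matrix_mul_assoc)
    then show ?thesis by (simp add: that(1) mat_prod_append matrix_mul_assoc)
  qed
  show ?case
  proof (cases "length As = 1")
    case True
    then obtain A where "As = [A]" by (auto simp: length_Suc_conv)
    then show ?thesis using less.prems by simp
  next
    case False
    then have len: "2 \<le> length As" using less.prems(1) by (cases As) (auto simp: Suc_le_eq)
    have um: "unimodular (mat_prod Bs)" if "set Bs \<subseteq> set As" for Bs
      using that less.prems(2) R by (intro unimodular_mat_prod) blast
    obtain i where i: "i \<le> length As" "\<And>j. j \<le> length As \<Longrightarrow> f j \<le> f i"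
      using ex_has_greatest_nat[of "\<lambda>i. i \<le> length As" 0 f "Suc (Max (f ` {..length As}))"]
      by (auto simp: less_Suc_eq_le)
    show ?thesis
    proof (cases "f i \<le> N")
      case True
      \<comment> \<open>If every prefix is short, so is the product of the first two letters, and
        they can be merged.\<close>
      obtain A B Vs where As: "As = A # B # Vs"
        using len by (cases As; cases "tl As") auto
      have "f 2 \<le> N" using i(2)[OF len] True by simp
      then show ?thesis
        using As by (intro shorten[of "[]" A B Vs]) (simp_all add: f_def numeral_2_eq_2)
    next
      case False
      \<comment> \<open>The empty and the full prefix are short, so the maximum is attained strictly
        inside the word.\<close>
      have "f (length As) \<le> N" using less.prems(3) by (simp add: f_def)
      then have "i \<noteq> length As" using False by metis
      have "f 0 \<le> N"
      proof -
        have "wall_len (mat 1) = 0" by (simp add: wall_len_def)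
        then show ?thesis by (simp add: f_def)
      qed
      then obtain k where k: "i = Suc k" using False by (cases i) auto
      define A B where "A = As ! k" and "B = As ! Suc k"
      have kl: "Suc k < length As" using k i(1) \<open>i \<noteq> length As\<close> by simp
      have t1: "mat_prod (take (Suc k) As) = mat_prod (take k As) ** A"
        using kl by (simp add: take_Suc_conv_app_nth mat_prod_append A_def)
      have t2: "mat_prod (take (Suc (Suc k)) As) = mat_prod (take k As) ** A ** B"
        using kl t1 by (simp add: take_Suc_conv_app_nth[of "Suc k"] mat_prod_append B_def)
      have AB: "A \<in> R" "B \<in> R" using kl less.prems(2) by (auto simp: A_def B_def)
      have "wall_len (A ** B) \<le> N"
      proof (rule wall_len_mult_four_point)
        show "unimodular (mat_prod (take k As))" by (rule um) (rule set_take_subset)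
        show "wall_len (mat_prod (take k As)) \<le> wall_len (mat_prod (take k As) ** A)"
          using i(2)[of k] kl t1 by (simp add: f_def k)
        show "wall_len (mat_prod (take k As) ** A ** B) \<le> wall_len (mat_prod (take k As) ** A)"
          using i(2)[of "Suc (Suc k)"] kl t1 t2 by (simp add: f_def k)
      qed (use R AB in auto)
      moreover have "As = take k As @ A # B # drop (Suc (Suc k)) As"
        using kl by (simp add: A_def B_def Cons_nth_drop_Suc)
      ultimately show ?thesis by (intro shorten)
    qed
  qed
qed

section \<open>Certificates\<close>

lemma abs_sum_inv2: "unimodular A \<Longrightarrow> abs_sum (inv2 A) = abs_sum A"
  by (simp add: inv2_def abs_sum_def abs_mult unimodular_def)

lemma left_inverse_eq_inv2:
  assumes "unimodular A" "B ** A = mat 1" shows "B = inv2 A"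
  using inv2_cancel(3)[OF assms(1), of B] assms(2) by simp

section \<open>Groups of integer matrices with an arbitrary neutral element\<close>

locale mat_group =
  fixes H :: "mat2 set" and e :: mat2
  assumes group: "group (mat_structure H e)"
begin

lemma closed: "A \<in> H \<Longrightarrow> B \<in> H \<Longrightarrow> A ** B \<in> H"
  using monoid.m_closed[OF group.axioms(1)[OF group], of A B] by (simp add: mat_structure_def)

lemma unit: "e \<in> H" "A \<in> H \<Longrightarrow> e ** A = A" "A \<in> H \<Longrightarrow> A ** e = A"
  using monoid.one_closed[OF group.axioms(1)[OF group]] monoid.l_one[OF group.axioms(1)[OF group], of A]
    monoid.r_one[OF group.axioms(1)[OF group], of A] by (simp_all add: mat_structure_def)

lemma inverse:
  assumes "A \<in> H" obtains B where "B \<in> H" "B ** A = e" "A ** B = e" "inv\<^bsub>mat_structure H e\<^esub> A = B"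
  using group.inv_closed[OF group, of A] group.l_inv[OF group, of A] group.r_inv[OF group, of A] assms
    that[of "inv\<^bsub>mat_structure H e\<^esub> A"] by (simp add: mat_structure_def)

text \<open>The determinant of an idempotent is 0 or 1, and an invertible idempotent is the
  identity. So a group of matrices is either entirely singular or a subgroup of GL(2, Z).\<close>

lemma unit_eq_one:
  assumes "det2 e \<noteq> 0" shows "e = mat 1"
proof -
  have "det2 e * det2 e = det2 e"
    using unit(2)[OF unit(1)] det2_mult[of e e] by simp
  then have "unimodular e" using assms by (simp add: unimodular_def)
  then show ?thesis
    using inv2_cancel(1)[of e e] unit(2)[OF unit(1)] inv2_left by metis
qed

lemma unimodular_mem:
  assumes "det2 e \<noteq> 0" "A \<in> H" shows "unimodular A"
proof -
  obtain B where "A ** B = mat 1"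
    using inverse[OF assms(2)] unit_eq_one[OF assms(1)] by metis
  then have "det2 A * det2 B = 1" using det2_mult[of A B] by simp
  then show ?thesis
    using abs_zmult_eq_1[of "det2 A" "det2 B"] by (simp add: unimodular_def)
qed

lemma not_unimodular_mem:
  assumes "det2 e = 0" "A \<in> H" shows "det2 A = 0" "\<not> unimodular A"
  using det2_mult[of e A] unit(2)[OF assms(2)] assms(1) by (simp_all add: unimodular_def)

text \<open>By Cayley-Hamilton, a singular \<open>A\<close> satisfies \<open>A ** A = t A\<close> with \<open>t\<close> its trace;
  cancelling \<open>A\<close> in the group gives \<open>A = t e\<close>, and \<open>t\<close> is a unit unless \<open>e = 0\<close>.\<close>

lemma singular_cases:
  assumes "det2 e = 0" "A \<in> H" shows "A = e \<or> A = - e"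
proof -
  have scalar: "\<exists>t. \<forall>i j. A $ i $ j = t * e $ i $ j" if A: "A \<in> H" for A
  proof -
    obtain B where B: "B ** A = e" using inverse[OF A] by metis
    define t where "t = A $ 1 $ 1 + A $ 2 $ 2"
    have "A $ 1 $ 1 * A $ 2 $ 2 = A $ 1 $ 2 * A $ 2 $ 1"
      using not_unimodular_mem(1)[OF assms(1) A] by (simp add: det2_def)
    then have square: "(A ** A) $ i $ j = t * A $ i $ j" for i j
      using exhaust_2[of i] exhaust_2[of j] by (auto simp: t_def algebra_simps)
    have "A = B ** (A ** A)"
      using B unit(2)[OF A] by (simp add: matrix_mul_assoc)
    then have "A $ i $ j = (B ** (A ** A)) $ i $ j" for i j by simp
    also have "(B ** (A ** A)) $ i $ j = t * (B ** A) $ i $ j" for i j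
      unfolding mat2_mult_nth[of B] square by (simp add: algebra_simps)
    finally show ?thesis using B by metis
  qed
  obtain B where B: "B \<in> H" "A ** B = e" using inverse[OF assms(2)] by metis
  obtain s t where st: "\<And>i j. A $ i $ j = s * e $ i $ j" "\<And>i j. B $ i $ j = t * e $ i $ j"
    using scalar assms(2) B(1) by metis
  have "(s * t) * (e ** e) $ i $ j = (A ** B) $ i $ j" for i j
    by (simp add: st algebra_simps)
  then have e: "(s * t) * e $ i $ j = e $ i $ j" for i j
    using B(2) unit(2)[OF unit(1)] by simp
  show ?thesis
  proof (cases "\<forall>i j. e $ i $ j = 0")
    case True
    then show ?thesis using st(1) by (simp add: vec_eq_iff)
  next
    case False
    then have "s * t = 1" using e by (metis mult_cancel_right2)
    then have "s = 1 \<or> s = -1" using zmult_eq_1_iff by blast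
    then show ?thesis using st(1) by (auto simp: vec_eq_iff)
  qed
qed

text \<open>Since \<open>- e\<close> and \<open>e\<close> have the same square, a generator of a
  singular group is its own inverse.\<close>

lemma singular_square:
  assumes "det2 e = 0" "A \<in> H" shows "A ** A = e"
proof -
  have "(- e) ** (- e) = e ** e" by (simp add: mat2_eq_iff)
  then show ?thesis
    using singular_cases[OF assms] unit(2)[OF unit(1)] by auto
qed

lemma finite_singular:
  assumes "det2 e = 0" shows "finite H"
  by (rule finite_subset[of _ "{e, - e}"]) (use singular_cases[OF assms] in auto)

end

text \<open>The neutral element is not part of the input, so the last clause refers to the identity
  matrix. It never applies to a singular generator, which is its own inverse.\<close>

definition derivable :: "mat2 set \<Rightarrow> mat2 set \<Rightarrow> mat2 \<Rightarrow> bool" where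
  "derivable S D A \<longleftrightarrow> A \<in> S \<or> (\<exists>B\<in>D. \<exists>C\<in>D. A = B ** C) \<or> (\<exists>B\<in>S. A ** B = mat 1)"

text \<open>Each entry is justified by the entries behind it, so a tail of a derivation is again
  one; this suits the recursive coding of lists.\<close>

primrec derivation :: "mat2 set \<Rightarrow> mat2 list \<Rightarrow> bool" where
  "derivation S [] \<longleftrightarrow> True"
| "derivation S (A # As) \<longleftrightarrow> derivable S (set As) A \<and> derivation S As"

lemma derivable_mono: "derivable S D A \<Longrightarrow> D \<subseteq> D' \<Longrightarrow> derivable S D' A"
  unfolding derivable_def by blast

lemma derivation_append: "derivation S As \<Longrightarrow> derivation S Bs \<Longrightarrow> derivation S (As @ Bs)"
  by (induction As) (auto intro: derivable_mono)

lemma derivation_iff_nth: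
  "derivation S As \<longleftrightarrow> (\<forall>i<length As. derivable S (set (drop (Suc i) As)) (As ! i))"
proof (induction As)
  case (Cons A As)
  show ?case unfolding derivation.simps Cons.IH by (auto simp: less_Suc_eq_0_disj)
qed simp

definition wall_len_bound :: "mat2 \<Rightarrow> nat" where
  "wall_len_bound A = nat (2 * abs_sum A + 1) ^ 4"

text \<open>A lower approximation of \<open>wall_len\<close>, computable as a bounded sum. A value
  above \<open>N\<close> proves that the true length exceeds \<open>N\<close>.\<close>

definition bounded_wall_len :: "nat \<Rightarrow> mat2 \<Rightarrow> nat" where
  "bounded_wall_len M A =
     card {K. mat_encode K < M \<and> unimodular K \<and> unimodular A \<and> pos K \<noteq> pos (K ** A)}"

lemma finite_wall_len: "finite {K. unimodular K \<and> unimodular A \<and> pos K \<noteq> pos (K ** A)}"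
  by (rule finite_subset[OF _ finite_box[of "abs_sum A"]]) (auto intro: separating_in_box)

lemma bounded_wall_len_le: "bounded_wall_len M A \<le> wall_len A"
  unfolding bounded_wall_len_def wall_len_def by (intro card_mono finite_wall_len) auto

text \<open>Lengths that must be small are estimated from above by \<open>wall_len_bound\<close>;
  products exempt from membership in \<open>R\<close> are shown to be long by a lower estimate. So
  acceptance is reliable for every choice of \<open>M\<close>, \<open>N\<close> and
  \<open>R\<close>. The alternative \<open>det2 B = 0\<close> admits singular generators.\<close>

definition excluded :: "nat \<Rightarrow> nat \<Rightarrow> mat2 set \<Rightarrow> mat2 set \<Rightarrow> mat2 \<Rightarrow> bool" where
  "excluded M N R S A \<longleftrightarrow>
     (\<forall>B\<in>S. B \<in> R \<and> wall_len_bound B \<le> N \<and> (det2 B = 0 \<or> (\<exists>C\<in>R. C ** B = mat 1))) \<and>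
     (\<forall>B\<in>R. \<forall>C\<in>R. B ** C \<in> R \<or> N < bounded_wall_len M (B ** C)) \<and>
     wall_len_bound A \<le> N \<and> A \<notin> R"

section \<open>Soundness and completeness of both kinds of certificate\<close>

locale mat_group_generated = mat_group +
  fixes S :: "mat2 set"
  assumes S: "S \<subseteq> H" "S \<noteq> {}" "finite S" and generate: "generate (mat_structure H e) S = H"
begin

lemma generated_induct [consumes 1, case_names one incl inv mult]:
  assumes A: "A \<in> H" and "P e" and "\<And>B. B \<in> S \<Longrightarrow> P B"
    and inv: "\<And>B C. B \<in> S \<Longrightarrow> C \<in> H \<Longrightarrow> B ** C = e \<Longrightarrow> C ** B = e \<Longrightarrow> P C"
    and mult: "\<And>B C. B \<in> H \<Longrightarrow> C \<in> H \<Longrightarrow> P B \<Longrightarrow> P C \<Longrightarrow> P (B ** C)"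
  shows "P A"
proof -
  have "A \<in> generate (mat_structure H e) S" using A generate by simp
  then show ?thesis
  proof induction
    case one
    then show ?case using assms(2) by (simp add: mat_structure_def)
  next
    case (incl h)
    then show ?case by (rule assms(3))
  next
    case (inv h)
    then obtain B where "B \<in> H" "B ** h = e" "h ** B = e" "inv\<^bsub>mat_structure H e\<^esub> h = B"
      using inverse[of h] S(1) by blast
    then show ?case using assms(4)[OF inv, of B] by simp
  next
    case (eng h1 h2)
    then show ?case using mult[of h1 h2] unfolding generate by (simp add: mat_structure_def)
  qed
qed

lemma derivation_sound: "derivation S As \<Longrightarrow> set As \<subseteq> H"
proof (induction As)
  case (Cons A As)
  \<comment> \<open>A generator invertible over the integers forces \<open>e\<close> to be the
    identity, so its inverse matrix is its inverse in the group.\<close>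
  have "A \<in> H" if "B \<in> S" "A ** B = mat 1" for B
  proof -
    have B: "B \<in> H" using that S(1) by blast
    have "det2 A * det2 B = 1" using det2_mult[of A B] that(2) by simp
    then have "det2 B \<noteq> 0" by auto
    then have "det2 e \<noteq> 0" using not_unimodular_mem(1)[OF _ B] by blast
    then have "e = mat 1" and um: "unimodular B"
      using unit_eq_one unimodular_mem B by blast+
    moreover obtain C where "C \<in> H" "C ** B = e" using inverse[OF B] by metis
    ultimately show ?thesis
      using left_inverse_eq_inv2[OF um] that(2) by metis
  qed
  moreover have "set As \<subseteq> H" using Cons by simp
  ultimately have "A \<in> H"
    using Cons.prems S(1) closed unfolding derivation.simps derivable_def by blast
  with \<open>set As \<subseteq> H\<close> show ?case by simp
qed simp

lemma derivation_complete:
  assumes "A \<in> H" shows "\<exists>As. derivation S As \<and> A \<in> set As"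
proof -
  have mult: "\<exists>As. derivation S As \<and> B ** C \<in> set As"
    if B: "\<exists>As. derivation S As \<and> B \<in> set As" and C: "\<exists>As. derivation S As \<and> C \<in> set As" for B C
  proof -
    obtain As Bs where "derivation S As" "B \<in> set As" "derivation S Bs" "C \<in> set Bs"
      using B C by blast
    then have "derivation S ((B ** C) # As @ Bs)"
      by (auto simp: derivable_def intro: derivation_append)
    then show ?thesis by (intro exI[of _ "(B ** C) # As @ Bs"]) simp
  qed
  have incl: "\<exists>As. derivation S As \<and> B \<in> set As" if "B \<in> S" for B
    using that by (intro exI[of _ "[B]"]) (simp add: derivable_def)
  have inv: "\<exists>As. derivation S As \<and> C \<in> set As" if "B \<in> S" "C \<in> H" "C ** B = e" for B C
  proof (cases "det2 e = 0")
    case True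
    have B: "B \<in> H" using that S(1) by blast
    have "C = C ** (B ** B)"
      using singular_square[OF True B] unit(3)[OF that(2)] by simp
    also have "\<dots> = B"
      using that(3) unit(2)[OF B] by (simp add: matrix_mul_assoc)
    finally show ?thesis using incl[OF that(1)] by simp
  next
    case False
    then show ?thesis
      using that unit_eq_one by (intro exI[of _ "[C]"]) (auto simp: derivable_def)
  qed
  show ?thesis
    using assms
  proof (induction rule: generated_induct)
    case one
    \<comment> \<open>\<open>e\<close> is derived as the product of a generator and its inverse,
      which exists because \<open>S\<close> is nonempty.\<close>
    obtain B where B: "B \<in> S" using S(2) by blast
    then obtain C where "C \<in> H" "C ** B = e" using inverse[of B] S(1) by blast
    then show ?case using mult[OF inv[OF B] incl[OF B]] by metis
  next
    case (inv B C)
    then show ?case using \<open>\<And>B C. B \<in> S \<Longrightarrow> C \<in> H \<Longrightarrow> C ** B = e \<Longrightarrow> _\<close> by blast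
  qed (use mult incl in blast)+
qed

text \<open>In the singular case all lengths are 0, so \<open>R\<close> absorbs every product.
  Otherwise \<open>A\<close> is a word in generators and their inverses, and local closure puts
  every short product of such letters into \<open>R\<close>, against
  \<open>A \<notin> R\<close>.\<close>

lemma excluded_sound:
  assumes ex: "excluded M N R S A" shows "A \<notin> H"
proof
  assume A: "A \<in> H"
  have gen: "B \<in> R" "wall_len_bound B \<le> N" "det2 B = 0 \<or> (\<exists>C\<in>R. C ** B = mat 1)" if "B \<in> S" for B
    using ex that by (auto simp: excluded_def)
  have closedR: "B ** C \<in> R" if "B \<in> R" "C \<in> R" "wall_len (B ** C) \<le> N" for B C
    using ex that bounded_wall_len_le[of M "B ** C"] by (force simp: excluded_def)
  show False
  proof (cases "det2 e = 0")
    case True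
    have small: "wall_len B \<le> N" if "B \<in> H" for B
      using wall_len_not_unimodular[OF not_unimodular_mem(2)[OF True that]] by simp
    have "A \<in> R"
      using A
    proof (induction rule: generated_induct)
      case one
      obtain B where B: "B \<in> S" "B \<in> H" using S by blast
      then show ?case
        using closedR[OF gen(1) gen(1), of B B] small[OF unit(1)] singular_square[OF True B(2)] by simp
    next
      case (inv B C)
      have B: "B \<in> H" using inv S(1) by blast
      have "C = C ** (B ** B)"
        using singular_square[OF True B] unit(3)[OF inv(2)] by simp
      also have "\<dots> = B"
        using inv(4) unit(2)[OF B] by (simp add: matrix_mul_assoc)
      finally show ?case using gen(1)[OF inv(1)] by simp
    next
      case (mult B C)
      then show ?case using closedR small closed by blast
    qed (rule gen(1))
    then show False using ex by (simp add: excluded_def)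
  next
    case False
    have e: "e = mat 1" by (rule unit_eq_one[OF False])
    \<comment> \<open>A certificate may put arbitrary matrices into \<open>R\<close>; only its short
      unimodular members are retained.\<close>
    define R' where "R' = {B \<in> R. unimodular B \<and> wall_len B \<le> N}"
    have SR': "B \<in> R'" if "B \<in> S" for B
      using gen(1,2)[OF that] wall_len_le_abs_sum[of B] unimodular_mem[OF False, of B] that S(1)
      by (auto simp: R'_def wall_len_bound_def)
    have inv_R': "C \<in> R'" if "B \<in> S" "C ** B = mat 1" for B C
    proof -
      have B: "unimodular B" using unimodular_mem[OF False] that S(1) by blast
      have C: "C = inv2 B" by (rule left_inverse_eq_inv2[OF B that(2)])
      have "\<exists>C'\<in>R. C' ** B = mat 1"
        using gen(3)[OF that(1)] B by (auto simp: unimodular_def)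
      then have "C \<in> R" using left_inverse_eq_inv2[OF B] C by metis
      moreover have "wall_len C \<le> N"
        using wall_len_le_abs_sum[of C] gen(2)[OF that(1)] abs_sum_inv2[OF B] C
        by (simp add: wall_len_bound_def)
      ultimately show ?thesis
        using unimodular_inv2[OF B] C by (simp add: R'_def)
    qed
    have "\<exists>As. As \<noteq> [] \<and> set As \<subseteq> R' \<and> A = mat_prod As"
      using A
    proof (induction rule: generated_induct)
      case one
      obtain B where B: "B \<in> S" using S(2) by blast
      then obtain C where "C ** B = e" using inverse[of B] S(1) by blast
      then show ?case using SR'[OF B] inv_R'[OF B] e by (intro exI[of _ "[C, B]"]) simp
    next
      case (incl B)
      then show ?case using SR' by (intro exI[of _ "[B]"]) simp
    next
      case (inv B C)
      then show ?case using inv_R' e by (intro exI[of _ "[C]"]) auto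
    next
      case (mult B C)
      then obtain As Bs where "As \<noteq> []" "set As \<subseteq> R'" "B = mat_prod As" "set Bs \<subseteq> R'" "C = mat_prod Bs"
        by blast
      then show ?case by (intro exI[of _ "As @ Bs"]) (simp add: mat_prod_append)
    qed
    then obtain As where As: "As \<noteq> []" "set As \<subseteq> R'" "A = mat_prod As" by blast
    have "wall_len A \<le> N"
      using ex wall_len_le_abs_sum[of A] by (simp add: excluded_def wall_len_bound_def)
    then have "A \<in> R'"
      unfolding As(3) using As
      by (intro mat_prod_mem_locally_closed[of R' N]) (auto simp: R'_def intro: closedR unimodular_mult)
    then show False using ex by (simp add: R'_def excluded_def)
  qed
qed

text \<open>The witness is the part of \<open>H\<close> of length at most \<open>N\<close>, finite
  by properness, with \<open>N\<close> large enough for \<open>A\<close> and all generators.\<close>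

lemma excluded_complete:
  assumes "A \<notin> H" shows "\<exists>M N R. finite R \<and> excluded M N R S A"
proof -
  define N where "N = Max (wall_len_bound ` insert A S)"
  have N: "wall_len_bound B \<le> N" if "B \<in> insert A S" for B
    unfolding N_def using that S(3) by (intro Max_ge) auto
  define R where "R = {B \<in> H. wall_len B \<le> N}"
  have fin: "finite R"
  proof (cases "det2 e = 0")
    case True
    then show ?thesis using finite_singular by (simp add: R_def)
  next
    case False
    then show ?thesis
      using unimodular_mem by (intro finite_subset[OF _ finite_wall_len_ball[of N]]) (auto simp: R_def)
  qed
  \<comment> \<open>All walls relevant to products of two members of \<open>R\<close>.
    \<open>M\<close> exceeds their codes, which makes the bounded count exact on these
    products.\<close>
  define T where "T = (\<Union>B\<in>R. \<Union>C\<in>R. {K. unimodular K \<and> unimodular (B ** C) \<and> pos K \<noteq> pos (K ** (B ** C))})"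
  have "finite (mat_encode ` T)"
    unfolding T_def using fin finite_wall_len by (intro finite_imageI finite_UN_I) auto
  then obtain M where M: "\<And>K. K \<in> T \<Longrightarrow> mat_encode K < M"
    unfolding finite_nat_set_iff_bounded by blast
  have count: "bounded_wall_len M (B ** C) = wall_len (B ** C)" if "B \<in> R" "C \<in> R" for B C
    unfolding bounded_wall_len_def wall_len_def
    by (rule arg_cong[of _ _ card]) (use that M in \<open>auto simp: T_def\<close>)
  have "excluded M N R S A"
    unfolding excluded_def
  proof (intro conjI ballI)
    fix B assume B: "B \<in> S"
    show "wall_len_bound B \<le> N" using N B by simp
    then show "B \<in> R"
      using B S(1) wall_len_le_abs_sum[of B] by (auto simp: R_def wall_len_bound_def)
    show "det2 B = 0 \<or> (\<exists>C\<in>R. C ** B = mat 1)"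
    proof (cases "det2 e = 0")
      case True
      then show ?thesis using not_unimodular_mem(1) B S(1) by blast
    next
      case False
      have um: "unimodular B" using unimodular_mem[OF False] B S(1) by blast
      obtain C where C: "C \<in> H" "C ** B = mat 1"
        using inverse[of B] B S(1) unit_eq_one[OF False] by blast
      have "wall_len C \<le> N"
        using wall_len_le_abs_sum[of C] N[of B] B abs_sum_inv2[OF um] left_inverse_eq_inv2[OF um C(2)]
        by (simp add: wall_len_bound_def)
      then show ?thesis using C by (auto simp: R_def)
    qed
  next
    fix B C assume "B \<in> R" "C \<in> R"
    then show "B ** C \<in> R \<or> N < bounded_wall_len M (B ** C)"
      using count closed by (auto simp: R_def)
  qed (use N assms in \<open>auto simp: R_def\<close>)
  then show ?thesis using fin by blast
qed

end

section \<open>Deciding membership\<close>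

text \<open>Programs compute on naturals, so an integer is handled through its positive and negative
  parts.\<close>

definition computable_int :: "((nat \<Rightarrow> nat) \<Rightarrow> int) \<Rightarrow> bool" where
  "computable_int F \<longleftrightarrow> computable (\<lambda>e. nat (F e)) \<and> computable (\<lambda>e. nat (- F e))"

lemma computable_int_of_nat_diff:
  assumes "computable A" "computable B" "\<And>e. F e = int (A e) - int (B e)"
  shows "computable_int F"
proof -
  have "nat (F e) = A e - B e" "nat (- F e) = B e - A e" for e
    using assms(3)[of e] by auto
  then show ?thesis
    unfolding computable_int_def using assms by (simp add: computable_diff)
qed

lemma computable_int_const: "computable_int (\<lambda>_. c)"
  by (simp add: computable_int_def computable_const)

lemma computable_int_diff:
  assumes "computable_int F" "computable_int G" shows "computable_int (\<lambda>e. F e - G e)"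
  using assms unfolding computable_int_def[of F] computable_int_def[of G]
  by (intro computable_int_of_nat_diff[of "\<lambda>e. nat (F e) + nat (- G e)" "\<lambda>e. nat (- F e) + nat (G e)"] computable_add) auto

lemma computable_int_add:
  assumes "computable_int F" "computable_int G" shows "computable_int (\<lambda>e. F e + G e)"
  using computable_int_diff[OF assms(1) computable_int_diff[OF computable_int_const assms(2), of 0]] by simp

lemma computable_int_mult:
  assumes "computable_int F" "computable_int G" shows "computable_int (\<lambda>e. F e * G e)"
proof -
  have *: "x * y = int (nat x * nat y + nat (- x) * nat (- y)) - int (nat x * nat (- y) + nat (- x) * nat y)" for x y
    by (cases "0 \<le> x"; cases "0 \<le> y") (auto simp: algebra_simps)
  show ?thesis
    using assms unfolding computable_int_def[of F] computable_int_def[of G]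
    by (intro computable_int_of_nat_diff[OF _ _ *] computable_add computable_mult) auto
qed

lemma computable_int_abs:
  assumes "computable_int F" shows "computable_int (\<lambda>e. \<bar>F e\<bar>)"
  using assms unfolding computable_int_def[of F]
  by (intro computable_int_of_nat_diff[of "\<lambda>e. nat (F e) + nat (- F e)" "\<lambda>_. 0"] computable_add computable_const) auto

lemma computable_nat: "computable_int F \<Longrightarrow> computable (\<lambda>e. nat (F e))"
  by (simp add: computable_int_def)

lemma computable_int_decode:
  assumes "computable A" shows "computable_int (\<lambda>e. int_decode (A e))"
  by (rule computable_int_of_nat_diff[of "\<lambda>e. if even (A e) then A e div 2 else 0"
        "\<lambda>e. if even (A e) then 0 else Suc (A e div 2)"])
    (auto intro!: computable_if decidable_even computable_div2 computable_Suc computable_const assms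
      simp: int_decode_def sum_decode_def)

lemma decidable_int_le:
  assumes "computable_int F" "computable_int G" shows "decidable (\<lambda>e. F e \<le> G e)"
proof -
  have "decidable (\<lambda>e. nat (F e - G e) \<le> 0)"
    by (intro decidable_le computable_nat computable_int_diff computable_const assms)
  then show ?thesis by simp
qed

lemma decidable_int_eq:
  assumes "computable_int F" "computable_int G" shows "decidable (\<lambda>e. F e = G e)"
  using decidable_conj[OF decidable_int_le[OF assms] decidable_int_le[OF assms(2,1)]]
  by (simp add: order_eq_iff)

section \<open>Computable matrices and their codes\<close>

definition computable_mat :: "((nat \<Rightarrow> nat) \<Rightarrow> mat2) \<Rightarrow> bool" where
  "computable_mat F \<longleftrightarrow> computable_int (\<lambda>e. F e $ 1 $ 1) \<and> computable_int (\<lambda>e. F e $ 1 $ 2) \<and>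
     computable_int (\<lambda>e. F e $ 2 $ 1) \<and> computable_int (\<lambda>e. F e $ 2 $ 2)"

lemma computable_int_entry:
  assumes "computable_mat F"
  shows "computable_int (\<lambda>e. F e $ 1 $ 1)" "computable_int (\<lambda>e. F e $ 1 $ 2)"
    "computable_int (\<lambda>e. F e $ 2 $ 1)" "computable_int (\<lambda>e. F e $ 2 $ 2)"
  using assms by (simp_all add: computable_mat_def)

lemma computable_mat_const: "computable_mat (\<lambda>_. A)"
  by (simp add: computable_mat_def computable_int_const)

lemma computable_mat_mult:
  "computable_mat F \<Longrightarrow> computable_mat G \<Longrightarrow> computable_mat (\<lambda>e. F e ** G e)"
  unfolding computable_mat_def mat2_mult_nth
  by (intro conjI computable_int_add computable_int_mult) simp_all

lemma decidable_mat_eq: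
  "computable_mat F \<Longrightarrow> computable_mat G \<Longrightarrow> decidable (\<lambda>e. F e = G e)"
  unfolding mat2_eq_iff by (intro decidable_conj decidable_int_eq computable_int_entry)

lemma computable_int_det2: "computable_mat F \<Longrightarrow> computable_int (\<lambda>e. det2 (F e))"
  unfolding det2_def by (intro computable_int_diff computable_int_mult computable_int_entry)

lemma decidable_unimodular: "computable_mat F \<Longrightarrow> decidable (\<lambda>e. unimodular (F e))"
  unfolding unimodular_def
  by (intro decidable_int_eq computable_int_abs computable_int_det2 computable_int_const)

lemma decidable_pos: "computable_mat F \<Longrightarrow> decidable (\<lambda>e. pos (F e))"
  unfolding pos_def
  by (intro decidable_conj decidable_int_le computable_int_mult computable_int_entry computable_int_const)

lemma computable_wall_len_bound: "computable_mat F \<Longrightarrow> computable (\<lambda>e. wall_len_bound (F e))"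
  unfolding wall_len_bound_def abs_sum_def power4_eq_xxxx
  by (intro computable_mult computable_nat computable_int_add computable_int_mult computable_int_abs
      computable_int_entry computable_int_const)

definition mat_decode :: "nat \<Rightarrow> mat2" where
  "mat_decode c = mat2_of (int_decode (code_hd c)) (int_decode (code_hd (code_tl c)))
     (int_decode (code_hd (code_tl (code_tl c)))) (int_decode (code_hd (code_tl (code_tl (code_tl c)))))"

lemma mat_decode_encode [simp]: "mat_decode (mat_encode A) = A"
  by (simp add: mat_decode_def mat_encode_def code_hd_def code_tl_def mat2_eq_iff)

lemma computable_mat_decode: "computable A \<Longrightarrow> computable_mat (\<lambda>e. mat_decode (A e))"
  unfolding computable_mat_def mat_decode_def mat2_of_nth
  by (intro conjI computable_int_decode computable_code_hd computable_code_tl)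

text \<open>\<open>mat_decode\<close> is total but not injective; comparing \<open>c\<close> with
  \<open>mat_encode (mat_decode c)\<close> recognises the genuine codes.\<close>

lemma mat_encode_decode:
  "mat_encode (mat_decode c) = list_encode [code_hd c, code_hd (code_tl c),
     code_hd (code_tl (code_tl c)), code_hd (code_tl (code_tl (code_tl c)))]"
  by (simp add: mat_decode_def mat_encode_def)

lemma computable_mat_encode_decode: "computable A \<Longrightarrow> computable (\<lambda>e. mat_encode (mat_decode (A e)))"
  unfolding mat_encode_decode list_encode.simps
  by (intro computable_Suc computable_prod_encode computable_code_hd computable_code_tl computable_const)

lemma computable_shift: "computable F \<Longrightarrow> computable (\<lambda>e. F (\<lambda>i. e (Suc i)))"
  by (rule computable_subst[of F "\<lambda>i e. e (Suc i)"]) (auto intro: computable_var)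

lemma computable_mat_shift: "computable_mat F \<Longrightarrow> computable_mat (\<lambda>e. F (\<lambda>i. e (Suc i)))"
  unfolding computable_mat_def computable_int_def by (intro conjI computable_shift) simp_all

lemma computable_bounded_wall_len:
  assumes "computable A" "computable_mat F"
  shows "computable (\<lambda>e. bounded_wall_len (A e) (F e))"
proof -
  \<comment> \<open>The first conjunct keeps one code per matrix, so that no \<open>K\<close> is
    counted twice.\<close>
  let ?P = "\<lambda>c G. mat_encode (mat_decode c) = c \<and> unimodular (mat_decode c) \<and> unimodular G \<and>
    \<not> (pos (mat_decode c) \<longleftrightarrow> pos (mat_decode c ** G))"
  have "computable (\<lambda>e. \<Sum>c<A e. of_bool (?P c (F e)))"
    by (intro computable_sum computable_of_bool decidable_conj decidable_eq decidable_not decidable_iff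
        computable_mat_encode_decode decidable_unimodular decidable_pos computable_mat_mult
        computable_mat_decode computable_var computable_mat_shift assms)
  moreover have "bounded_wall_len M G = (\<Sum>c<M. of_bool (?P c G))" for M G
  proof -
    have "inj mat_encode" by (rule inj_on_inverseI) (rule mat_decode_encode)
    have "(\<Sum>c<M. of_bool (?P c G)) = card {c. c < M \<and> ?P c G}"
      by (simp add: Int_def)
    also have "{c. c < M \<and> ?P c G} =
        mat_encode ` {K. mat_encode K < M \<and> unimodular K \<and> unimodular G \<and> pos K \<noteq> pos (K ** G)}"
      by (auto simp: image_iff) (metis mat_decode_encode)+
    also have "card \<dots> = bounded_wall_len M G"
      unfolding bounded_wall_len_def using \<open>inj mat_encode\<close> by (intro card_image) (auto intro: inj_on_subset)
    finally show ?thesis by simp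
  qed
  ultimately show ?thesis by simp
qed

section \<open>Finite sets of matrices and decidability of certificates\<close>

definition mat_set_decode :: "nat \<Rightarrow> mat2 set" where
  "mat_set_decode c = mat_decode ` code_set c"

lemma mat_set_decode_encode: "mat_set_decode (list_encode (map mat_encode As)) = set As"
  by (simp add: mat_set_decode_def code_set_list_encode image_image)

lemma decidable_mat_set_bex:
  assumes "computable B" "decidable (\<lambda>e. P (mat_decode (e 0)) (\<lambda>i. e (Suc i)))"
  shows "decidable (\<lambda>e. \<exists>A\<in>mat_set_decode (B e). P A e)"
  unfolding mat_set_decode_def bex_simps using assms by (rule decidable_code_set_bex)

lemma decidable_mat_set_ball:
  assumes "computable B" "decidable (\<lambda>e. P (mat_decode (e 0)) (\<lambda>i. e (Suc i)))"
  shows "decidable (\<lambda>e. \<forall>A\<in>mat_set_decode (B e). P A e)"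
  unfolding mat_set_decode_def ball_simps using assms by (rule decidable_code_set_ball)

lemma decidable_mat_set_mem:
  assumes "computable_mat F" "computable B"
  shows "decidable (\<lambda>e. F e \<in> mat_set_decode (B e))"
proof -
  have "decidable (\<lambda>e. \<exists>A\<in>mat_set_decode (B e). F e = A)"
    by (intro decidable_mat_set_bex decidable_mat_eq computable_mat_shift computable_mat_decode
        computable_var assms)
  then show ?thesis by simp
qed

lemmas computable_intros =
  computable_var computable_const computable_Suc computable_code_hd computable_code_tl computable_code_drop
  computable_fst_prod_decode computable_snd_prod_decode computable_wall_len_bound computable_bounded_wall_len
  computable_int_const computable_int_det2 computable_mat_mult computable_mat_decode computable_mat_const
  decidable_conj decidable_disj decidable_not decidable_imp decidable_less decidable_le decidable_eq
  decidable_int_eq decidable_mat_eq decidable_ball decidable_mat_set_bex decidable_mat_set_ball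
  decidable_mat_set_mem

text \<open>Variable 0 holds the certificate as a nested pair (M, (N, R)), variable 1 the matrix and
  variable 2 the generators.\<close>

lemma decidable_excluded:
  "decidable (\<lambda>e. excluded (fst (prod_decode (e 0))) (fst (prod_decode (snd (prod_decode (e 0)))))
     (mat_set_decode (snd (prod_decode (snd (prod_decode (e 0)))))) (mat_set_decode (e 2)) (mat_decode (e 1)))"
  unfolding excluded_def by (intro computable_intros)

text \<open>Positions in the list become iterated tails of its code, so only bounded quantifiers
  remain. Positions past the end, allowed by the bound \<open>c\<close>, have tail code 0 and are
  let through.\<close>

lemma derivation_code_iff:
  "derivation S (map mat_decode (list_decode c)) \<longleftrightarrow>
     (\<forall>i<c. (code_tl ^^ i) c = 0 \<or>
        derivable S (mat_set_decode (code_tl ((code_tl ^^ i) c))) (mat_decode (code_hd ((code_tl ^^ i) c))))"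
proof -
  let ?xs = "list_decode c"
  have step: "derivable S (set (drop (Suc i) (map mat_decode ?xs))) (map mat_decode ?xs ! i) \<longleftrightarrow>
      derivable S (mat_set_decode (code_tl ((code_tl ^^ i) c))) (mat_decode (code_hd ((code_tl ^^ i) c)))"
    if "i < length ?xs" for i
    using that list_decode_code_drop[of "Suc i" c] code_hd_drop[OF that]
    by (simp add: mat_set_decode_def code_set_def drop_map)
  show ?thesis
    unfolding derivation_iff_nth code_drop_eq_0 length_map
    using step length_list_decode_le[of c] by (meson leI leD order_less_le_trans)
qed

lemma decidable_derivation:
  "decidable (\<lambda>e. mat_decode (e 1) \<in> mat_set_decode (e 0) \<and>
     derivation (mat_set_decode (e 2)) (map mat_decode (list_decode (e 0))))"
  unfolding derivation_code_iff derivable_def by (intro computable_intros)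

text \<open>\<open>computable\<close> leaves the arity open; here it is fixed at \<open>k\<close>,
  with \<open>Zero\<close> read for the variables beyond the arguments.\<close>

lemma computable_fixed_arity:
  assumes "computable F"
  obtains f where "\<And>xs. length xs = k \<Longrightarrow> eval f xs = Some (F (\<lambda>i. if i < k then xs ! i else 0))"
proof -
  obtain f n where f: "\<And>e. eval f (map e [0..<n]) = Some (F e)"
    using assms unfolding computable_def by blast
  have "eval (Comp f (map (\<lambda>i. if i < k then Proj i else Zero) [0..<n])) xs =
      Some (F (\<lambda>i. if i < k then xs ! i else 0))" if "length xs = k" for xs
    using that by (subst eval_Comp_map[where h = "\<lambda>i. if i < k then xs ! i else 0"]) (simp_all add: f)
  then show thesis by (rule that)
qed

text \<open>\<open>Mu\<close> stops at the least certificate of either kind, where \<open>g\<close>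
  is 0, and \<open>h\<close> reports its kind. The conclusion speaks only of some certificate
  \<open>w\<close>; once both kinds are sound, any of them gives the right answer.\<close>

lemma search_certificate:
  assumes "decidable (\<lambda>e. P (e 0) (e 1) (e 2))" "decidable (\<lambda>e. Q (e 0) (e 1) (e 2))"
  obtains f where "\<And>x y w. P w x y \<or> Q w x y \<Longrightarrow> \<exists>w. (P w x y \<or> Q w x y) \<and>
    eval f [x, y] = Some (of_bool (P w x y))"
proof -
  have "computable (\<lambda>e. of_bool (\<not> (P (e 0) (e 1) (e 2) \<or> Q (e 0) (e 1) (e 2))))"
    by (intro computable_of_bool decidable_not decidable_disj assms)
  then obtain g where "\<And>xs. length xs = 3 \<Longrightarrow> eval g xs = Some (of_bool
      (\<not> (P (if (0 :: nat) < 3 then xs ! 0 else 0) (if (1 :: nat) < 3 then xs ! 1 else 0) (if (2 :: nat) < 3 then xs ! 2 else 0) \<or>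
          Q (if (0 :: nat) < 3 then xs ! 0 else 0) (if (1 :: nat) < 3 then xs ! 1 else 0) (if (2 :: nat) < 3 then xs ! 2 else 0))))"
    using computable_fixed_arity[where k = 3] by blast
  from this[of "[_, _, _]"] have g: "eval g [w, x, y] = Some (of_bool (\<not> (P w x y \<or> Q w x y)))" for w x y
    by (simp add: numeral_eq_Suc)
  have "computable (\<lambda>e. of_bool (P (e 0) (e 1) (e 2)))"
    by (intro computable_of_bool assms)
  then obtain h where "\<And>xs. length xs = 3 \<Longrightarrow> eval h xs = Some (of_bool
      (P (if (0 :: nat) < 3 then xs ! 0 else 0) (if (1 :: nat) < 3 then xs ! 1 else 0) (if (2 :: nat) < 3 then xs ! 2 else 0)))"
    using computable_fixed_arity[where k = 3] by blast
  from this[of "[_, _, _]"] have h: "eval h [w, x, y] = Some (of_bool (P w x y))" for w x y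
    by (simp add: numeral_eq_Suc)
  have "\<exists>w. (P w x y \<or> Q w x y) \<and> eval (Comp h [Mu g, Proj 0, Proj 1]) [x, y] = Some (of_bool (P w x y))"
    if "P w x y \<or> Q w x y" for x y w
  proof -
    define m where "m = (LEAST w. P w x y \<or> Q w x y)"
    have "eval (Mu g) [x, y] = Some m"
      using that by (auto simp: g m_def)
    then have "eval (Comp h [Mu g, Proj 0, Proj 1]) [x, y] = Some (of_bool (P m x y))"
      using h by (simp del: eval.simps(6))
    moreover have "P m x y \<or> Q m x y" unfolding m_def by (rule LeastI) (rule that)
    ultimately show ?thesis by blast
  qed
  then show thesis by (rule that)
qed

text \<open>The program sees only the codes of the matrices, neither \<open>H\<close> nor its
  neutral element. An empty list would generate every trivial group and so not determine the
  answer.\<close>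

theorem theorem5:
  "\<exists>f :: recf. \<forall>(Y :: mat2) (hs :: mat2 list) (H :: mat2 set).
     hs \<noteq> [] \<longrightarrow> generates_subgroup hs H \<longrightarrow>
       eval f [mat_encode Y, list_encode (map mat_encode hs)]
         = Some (if Y \<in> H then 1 else 0)"
proof -
  let ?P = "\<lambda>w y h. mat_decode y \<in> mat_set_decode w \<and>
    derivation (mat_set_decode h) (map mat_decode (list_decode w))"
  let ?Q = "\<lambda>w y h. excluded (fst (prod_decode w)) (fst (prod_decode (snd (prod_decode w))))
    (mat_set_decode (snd (prod_decode (snd (prod_decode w))))) (mat_set_decode h) (mat_decode y)"
  obtain f where f: "\<And>y h w. ?P w y h \<or> ?Q w y h \<Longrightarrow>
      \<exists>w. (?P w y h \<or> ?Q w y h) \<and> eval f [y, h] = Some (of_bool (?P w y h))"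
    using search_certificate[of ?P ?Q, OF decidable_derivation decidable_excluded] by blast
  show ?thesis
  proof (intro exI allI impI)
    fix Y :: mat2 and hs :: "mat2 list" and H :: "mat2 set"
    assume hs: "hs \<noteq> []" "generates_subgroup hs H"
    then obtain e where "mat_group_generated H e (set hs)"
      unfolding generates_subgroup_def
      by (auto simp: mat_group_generated_def mat_group_def mat_group_generated_axioms_def)
    then interpret mat_group_generated H e "set hs" .
    let ?y = "mat_encode Y" and ?h = "list_encode (map mat_encode hs)"
    have P: "Y \<in> H" if "?P w ?y ?h" for w
    proof -
      have "Y \<in> set (map mat_decode (list_decode w))"
        using that by (auto simp: mat_set_decode_def code_set_def)
      then show ?thesis
        using that derivation_sound unfolding mat_set_decode_encode by blast
    qed
    have Q: "Y \<notin> H" if "?Q w ?y ?h" for w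
      using that excluded_sound unfolding mat_set_decode_encode mat_decode_encode by blast
    have "\<exists>w. ?P w ?y ?h \<or> ?Q w ?y ?h"
    proof (cases "Y \<in> H")
      case True
      then obtain As where As: "derivation (set hs) As" "Y \<in> set As"
        using derivation_complete by blast
      then have "?P (list_encode (map mat_encode As)) ?y ?h"
        by (simp add: mat_set_decode_encode comp_def)
      then show ?thesis by blast
    next
      case False
      then obtain M N R where R: "finite R" "excluded M N R (set hs) Y"
        using excluded_complete by blast
      obtain As where "set As = R" using finite_list[OF R(1)] by blast
      then have "?Q (prod_encode (M, prod_encode (N, list_encode (map mat_encode As)))) ?y ?h"
        using R(2) by (simp add: mat_set_decode_encode)
      then show ?thesis by blast
    qed
    then obtain w where w: "?P w ?y ?h \<or> ?Q w ?y ?h" "eval f [?y, ?h] = Some (of_bool (?P w ?y ?h))"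
      using f by blast
    \<comment> \<open>The search may stop at any \<open>w\<close>; a certificate of the second kind
      rules out \<open>Y \<in> H\<close>, so the kind of \<open>w\<close> settles
      membership.\<close>
    then have "?P w ?y ?h \<longleftrightarrow> Y \<in> H"
      using P Q by blast
    then show "eval f [?y, ?h] = Some (if Y \<in> H then 1 else 0)"
      using w(2) by simp
  qed
qed

end
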